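(* Let $G$ be a digraph such that the out-neighborhood complex $\overrightarrow{\mathcal{N}}(G)$ has exactly $n>0$ vertices. Then there is a homotopy equivalence $$\overrightarrow{\mathcal{N}}(M^1(G)) \simeq \overrightarrow{\mathcal{N}}(G)\sqcup\{\mathrm{pt}\},$$ and an isomorphism of simplicial complexes $$\overrightarrow{\mathcal{N}}(M^2(G)) \cong \overrightarrow{\mathcal{N}}(G)\sqcup\Delta^{n-1},$$ where $\Delta^{n-1}$ is a simplex of dimension $n-1$. In particular, $\overrightarrow{\mathcal{N}}(M^1(G))\simeq\overrightarrow{\mathcal{N}}(M^2(G))$. In addition, there is a homotopy equivalence $$\overrightarrow{\mathcal{N}}(M^3(G)) \simeq S(\overrightarrow{\mathcal{N}}(G)),$$ where $S(X)$ denotes the suspension of the topological space $X$.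
   Context: A digraph $G$ consists of a finite vertex set $V(G)$ and an edge set $E(G)\subseteq V(G)\times V(G)$ (loops are allowed, and $(v,w)$ and $(w,v)$ may both be edges). The product $G\times H$ has vertex set $V(G)\times V(H)$, with $((g,h),(g',h'))$ an edge iff $(g,g')\in E(G)$ and $(h,h')\in E(H)$. For an equivalence relation $\sim$ on $V(G)$, the quotient $G/\!\sim$ has the equivalence classes as vertices and $([x],[y])$ as an edge iff $(x',y')\in E(G)$ for some $x'\in[x]$, $y'\in[y]$. For $v\in V(G)$ put $\overrightarrow{N}_G(v)=\{w:(v,w)\in E(G)\}$. The out-neighborhood complex $\overrightarrow{\mathcal{N}}(G)$ is the simplicial complex on vertex set $\{v\in V(G):\mathrm{indeg}(v)>0\}$ generated by the sets $\overrightarrow{N}_G(v)$, $v\in V(G)$ (a nonempty set of vertices is a face iff it is contained in some $\overrightarrow{N}_G(v)$). Let $I^1,I^2,I^3$ be the digraphs on vertex set $\{0,1,2\}$ with edge sets $E(I^1)=\{(0,0),(0,1),(1,2)\}$, $E(I^2)=\{(0,0),(1,0),(2,1)\}$, $E(I^3)=\{(1,1),(0,1),(1,2)\}$. The directed Mycielskians of $G$ are $M^1(G)=(G\times I^1)/\{(g,2)\sim(h,2)\ \forall g,h\in V(G)\}$, $M^2(G)=(G\times I^2)/\{(g,2)\sim(h,2)\ \forall g,h\in V(G)\}$, $M^3(G)=(G\times I^3)/\{(g,2)\sim(h,2)\text{ and }(g,0)\sim(h,0)\ \forall g,h\in V(G)\}$. *)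

theory Defs
  imports "HOL-Analysis.Analysis" "Graph_Theory.Pair_Digraph"
begin

section \<open>Digraphs\<close>

text \<open>
  A digraph is a \<open>pair_pre_digraph\<close> satisfying \<open>pair_fin_digraph\<close>: finitely many vertices, edges
  are ordered pairs of vertices, loops are allowed.
\<close>

definition digraph_prod :: "'a pair_pre_digraph \<Rightarrow> 'b pair_pre_digraph \<Rightarrow> ('a \<times> 'b) pair_pre_digraph"
  where "digraph_prod G H =
    \<lparr> pverts = pverts G \<times> pverts H,
      parcs = {((g, h), (g', h')) | g h g' h'. (g, g') \<in> parcs G \<and> (h, h') \<in> parcs H} \<rparr>"

definition digraph_quotient :: "'a pair_pre_digraph \<Rightarrow> 'a rel \<Rightarrow> 'a set pair_pre_digraph"
  where "digraph_quotient G r =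
    \<lparr> pverts = pverts G // r,
      parcs = {(A, B). A \<in> pverts G // r \<and> B \<in> pverts G // r \<and>
                       (\<exists>x\<in>A. \<exists>y\<in>B. (x, y) \<in> parcs G)} \<rparr>"

lemma pair_fin_digraph_prod:
  assumes "pair_fin_digraph G" "pair_fin_digraph H"
  shows "pair_fin_digraph (digraph_prod G H)"
proof -
  interpret G: pair_fin_digraph G by fact
  interpret H: pair_fin_digraph H by fact
  have sub: "parcs (digraph_prod G H) \<subseteq> pverts (digraph_prod G H) \<times> pverts (digraph_prod G H)"
    by (auto simp: digraph_prod_def dest: G.wellformed' H.wellformed')
  have fin: "finite (pverts (digraph_prod G H))"
    by (simp add: digraph_prod_def G.pair_finite_verts H.pair_finite_verts)
  show ?thesis
    using sub fin by unfold_locales (auto intro: finite_subset)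
qed

lemma pair_fin_digraph_quotient:
  assumes "pair_fin_digraph G" "equiv (pverts G) r"
  shows "pair_fin_digraph (digraph_quotient G r)"
proof -
  interpret G: pair_fin_digraph G by fact
  have sub: "parcs (digraph_quotient G r) \<subseteq>
      pverts (digraph_quotient G r) \<times> pverts (digraph_quotient G r)"
    by (auto simp: digraph_quotient_def)
  have "r \<subseteq> pverts G \<times> pverts G"
    using assms(2) by (rule equiv_type)
  then have fin: "finite (pverts (digraph_quotient G r))"
    by (simp add: digraph_quotient_def finite_quotient G.pair_finite_verts)
  show ?thesis
    using sub fin by unfold_locales (auto intro: finite_subset)
qed

section \<open>Directed Mycielskians\<close>

definition I1 :: "nat pair_pre_digraph"
  where "I1 = \<lparr> pverts = {0, 1, 2}, parcs = {(0, 0), (0, 1), (1, 2)} \<rparr>"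

definition I2 :: "nat pair_pre_digraph"
  where "I2 = \<lparr> pverts = {0, 1, 2}, parcs = {(0, 0), (1, 0), (2, 1)} \<rparr>"

definition I3 :: "nat pair_pre_digraph"
  where "I3 = \<lparr> pverts = {0, 1, 2}, parcs = {(1, 1), (0, 1), (1, 2)} \<rparr>"

text \<open>
  The equivalence relation on \<open>A\<close> generated by \<open>(g, i) \<sim> (h, i)\<close> for all \<open>g\<close>, \<open>h\<close> and all \<open>i \<in> S\<close>.
\<close>

definition merge_layers :: "('a \<times> 'b) set \<Rightarrow> 'b set \<Rightarrow> ('a \<times> 'b) rel"
  where "merge_layers A S =
    {(p, q). p \<in> A \<and> q \<in> A \<and> (p = q \<or> snd p = snd q \<and> snd p \<in> S)}"

lemma equiv_merge_layers: "equiv A (merge_layers A S)"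
  by (rule equivI) (auto simp: merge_layers_def refl_on_def sym_def trans_def)

definition mycielskian1 :: "'a pair_pre_digraph \<Rightarrow> ('a \<times> nat) set pair_pre_digraph"
  where "mycielskian1 G =
    digraph_quotient (digraph_prod G I1) (merge_layers (pverts (digraph_prod G I1)) {2})"

definition mycielskian2 :: "'a pair_pre_digraph \<Rightarrow> ('a \<times> nat) set pair_pre_digraph"
  where "mycielskian2 G =
    digraph_quotient (digraph_prod G I2) (merge_layers (pverts (digraph_prod G I2)) {2})"

definition mycielskian3 :: "'a pair_pre_digraph \<Rightarrow> ('a \<times> nat) set pair_pre_digraph"
  where "mycielskian3 G =
    digraph_quotient (digraph_prod G I3) (merge_layers (pverts (digraph_prod G I3)) {0, 2})"

section \<open>Abstract simplicial complexes\<close>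

text \<open>
  A complex is represented by the set of its nonempty faces; every vertex is a face, so its
  vertex set is \<open>\<Union>K\<close>.
\<close>

definition abstract_simplicial_complex :: "'a set set \<Rightarrow> bool"
  where "abstract_simplicial_complex K \<longleftrightarrow>
    (\<forall>\<sigma>\<in>K. finite \<sigma> \<and> \<sigma> \<noteq> {}) \<and> (\<forall>\<sigma>\<in>K. \<forall>\<tau>. \<tau> \<noteq> {} \<and> \<tau> \<subseteq> \<sigma> \<longrightarrow> \<tau> \<in> K)"

definition complex_verts :: "'a set set \<Rightarrow> 'a set"
  where "complex_verts K = \<Union>K"

definition complex_isomorphic :: "'a set set \<Rightarrow> 'b set set \<Rightarrow> bool"
  where "complex_isomorphic K L \<longleftrightarrow>
    (\<exists>f. bij_betw f (complex_verts K) (complex_verts L) \<and>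
         (\<forall>\<sigma>. \<sigma> \<subseteq> complex_verts K \<longrightarrow> (\<sigma> \<in> K \<longleftrightarrow> f ` \<sigma> \<in> L)))"

definition complex_disjoint_union :: "'a set set \<Rightarrow> 'b set set \<Rightarrow> ('a + 'b) set set"
  where "complex_disjoint_union K L = (\<lambda>\<sigma>. Inl ` \<sigma>) ` K \<union> (\<lambda>\<sigma>. Inr ` \<sigma>) ` L"

definition simplex_complex :: "nat \<Rightarrow> nat set set"
  where "simplex_complex d = {\<sigma>. \<sigma> \<noteq> {} \<and> \<sigma> \<subseteq> {0..d}}"

definition out_nbhd :: "'a pair_pre_digraph \<Rightarrow> 'a \<Rightarrow> 'a set"
  where "out_nbhd G v = {w. (v, w) \<in> parcs G}"

definition out_nbhd_complex :: "'a pair_pre_digraph \<Rightarrow> 'a set set"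
  where "out_nbhd_complex G = {\<sigma>. \<sigma> \<noteq> {} \<and> (\<exists>v\<in>pverts G. \<sigma> \<subseteq> out_nbhd G v)}"

lemma abstract_simplicial_complex_out_nbhd_complex:
  assumes "pair_fin_digraph G"
  shows "abstract_simplicial_complex (out_nbhd_complex G)"
proof -
  interpret pair_fin_digraph G by fact
  have "out_nbhd G v \<subseteq> pverts G" for v
    by (auto simp: out_nbhd_def dest: wellformed')
  then have "finite (out_nbhd G v)" for v
    using pair_finite_verts finite_subset by blast
  then show ?thesis
    unfolding abstract_simplicial_complex_def out_nbhd_complex_def
    by (blast intro: finite_subset subset_trans)
qed

lemma complex_verts_out_nbhd_complex:
  assumes "pair_fin_digraph G"
  shows "complex_verts (out_nbhd_complex G) = {v \<in> pverts G. in_degree (with_proj G) v > 0}"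
proof -
  interpret pair_fin_digraph G by fact
  have deg: "in_degree (with_proj G) v > 0 \<longleftrightarrow> (\<exists>u. (u, v) \<in> parcs G)" for v
    using pair_finite_arcs by (force simp: in_degree_def in_arcs_def card_gt_0_iff)
  show ?thesis
  proof (intro set_eqI iffI)
    fix v assume "v \<in> complex_verts (out_nbhd_complex G)"
    then show "v \<in> {v \<in> pverts G. in_degree (with_proj G) v > 0}"
      by (auto simp: deg complex_verts_def out_nbhd_complex_def out_nbhd_def dest: wellformed')
  next
    fix v assume "v \<in> {v \<in> pverts G. in_degree (with_proj G) v > 0}"
    then obtain u where "(u, v) \<in> parcs G"
      by (auto simp: deg)
    then have "{v} \<in> out_nbhd_complex G"
      by (auto simp: out_nbhd_complex_def out_nbhd_def dest: wellformed')
    then show "v \<in> complex_verts (out_nbhd_complex G)"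
      by (auto simp: complex_verts_def)
  qed
qed

section \<open>Topological constructions\<close>

text \<open>
  Barycentric coordinates, extended by zero, with the topology of pointwise convergence.  This is
  the usual topology of the geometric realization only for finite complexes, such as the
  out-neighborhood complexes of finite digraphs.
\<close>

definition realization :: "'a set set \<Rightarrow> ('a \<Rightarrow> real) topology"
  where "realization K = subtopology (powertop_real UNIV)
    {x. (\<forall>v. 0 \<le> x v) \<and> {v. x v \<noteq> 0} \<in> K \<and> (\<Sum>v | x v \<noteq> 0. x v) = 1}"

text \<open>
  Topological disjoint union with a point.  \<open>sum_topology\<close> tags the summands, so \<open>undefined\<close> is
  a new point (tagged \<open>False\<close>) even if it happens to belong to \<open>X\<close>.
\<close>

definition disjoint_point :: "'a topology \<Rightarrow> (bool \<times> 'a) topology"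
  where "disjoint_point X =
    sum_topology (\<lambda>b. if b then X else discrete_topology {undefined}) UNIV"

definition quotient_topology :: "'a topology \<Rightarrow> 'a rel \<Rightarrow> 'a set topology"
  where "quotient_topology X r = topology (\<lambda>U. U \<subseteq> topspace X // r \<and> openin X (\<Union>U))"

lemma istopology_quotient:
  assumes "equiv (topspace X) r"
  shows "istopology (\<lambda>U. U \<subseteq> topspace X // r \<and> openin X (\<Union>U))"
proof -
  have "\<Union>(S \<inter> T) = \<Union>S \<inter> \<Union>T" if "S \<subseteq> topspace X // r" "T \<subseteq> topspace X // r" for S T
  proof
    show "\<Union>S \<inter> \<Union>T \<subseteq> \<Union>(S \<inter> T)"
    proof
      fix x assume "x \<in> \<Union>S \<inter> \<Union>T"
      then obtain A B where AB: "A \<in> S" "B \<in> T" "x \<in> A" "x \<in> B"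
        by auto
      moreover have "A = B"
        using quotient_disj[OF assms, of A B] AB that by blast
      ultimately show "x \<in> \<Union>(S \<inter> T)"
        by auto
    qed
  qed auto
  moreover have "\<Union>(\<Union>\<K>) = (\<Union>U\<in>\<K>. \<Union>U)" for \<K> :: "'a set set set"
    by auto
  ultimately show ?thesis
    unfolding istopology_def by (auto intro: openin_Int)
qed

lemma openin_quotient_topology:
  assumes "equiv (topspace X) r"
  shows "openin (quotient_topology X r) U \<longleftrightarrow> U \<subseteq> topspace X // r \<and> openin X (\<Union>U)"
  by (simp add: quotient_topology_def istopology_quotient[OF assms] topology_inverse')

text \<open>
  The unreduced suspension: the quotient of \<open>X \<times> [0,1]\<close> identifying \<open>X \<times> {0}\<close> to one point and
  \<open>X \<times> {1}\<close> to another.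
\<close>

definition suspension :: "'a topology \<Rightarrow> ('a \<times> real) set topology"
  where "suspension X =
    (let C = prod_topology X (top_of_set {0..1})
     in quotient_topology C (merge_layers (topspace C) {0, 1}))"

end

theory Submission
  imports Defs
begin

text \<open>
  Write \<open>N\<close> for the out-neighborhood complex of \<open>G\<close> and \<open>P\<close> for its vertex set.  Listing the
  out-neighborhoods in the three Mycielskians identifies their complexes.

  For \<open>M\<^sup>1\<close>, each vertex \<open>(g, 0)\<close> sees two copies of the out-neighborhood of \<open>g\<close>, in layers \<open>0\<close> and \<open>1\<close>,
  which generates a thickened copy of \<open>N\<close>.  The vertices \<open>(g, 1)\<close> only see the merged vertex, which is therefore an isolated point.  Forgetting the
  layer is a simplicial map to \<open>N\<close> and a disjoint point, and the inclusion of layer \<open>0\<close> is its inverse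
  up to contiguity.  For \<open>M\<^sup>2\<close>, the out-neighborhoods of \<open>(g, 0)\<close> and \<open>(g, 1)\<close> generate a copy of \<open>N\<close> in
  layer \<open>0\<close>, and the merged vertex sees a copy of all of \<open>P\<close> in layer \<open>1\<close>, which gives a disjoint simplex
  on \<open>n\<close> vertices.  Replacing the point by a simplex of any dimension does not change
  the homotopy type, so both complexes are compared with the disjoint union of \<open>N\<close> and a simplex
  (\<open>mycielskian1_homotopy_equivalent\<close>, \<open>mycielskian2_isomorphic\<close>).

  For \<open>M\<^sup>3\<close> the complex is the cone over \<open>N\<close> together with the full simplex on \<open>P\<close>
  (\<open>mycielskian3_isomorphic\<close>).  The simplex is contractible, so it plays the role of a second cone over
  \<open>N\<close>, and the result is a suspension.  Instead of a homotopy extension argument, the proof of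
  \<open>cone_with_simplex_homotopy_equivalent_suspension_complex\<close> writes down both maps.  From the suspension,
  the second pole is sent to the barycenter of the simplex.  In the other direction a point \<open>x\<close> of the
  simplex is truncated at the height \<open>\<rho>(x) = min\<^sub>\<tau> (\<Sum>v\<in>P - \<tau>. x v)\<close>, with \<open>\<tau>\<close> ranging over the faces of
  \<open>N\<close>: what remains is supported on a face of \<open>N\<close>, the number \<open>\<rho>(x)\<close> vanishes exactly on \<open>N\<close>, and it
  serves as the weight of the second pole.

  All homotopies are straight lines in barycentric coordinates.  They exist as soon as at each point
  the supports of the two values lie in a common face (\<open>homotopic_contiguous_maps\<close>).  The two passages
  between complexes and spaces, for the disjoint point and for the suspension, are continuous bijections
  from a compact space to a Hausdorff space.
\<close>

section \<open>Maps between geometric realizations\<close>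

lemma abstract_simplicial_complexD:
  assumes "abstract_simplicial_complex K" "\<sigma> \<in> K"
  shows "\<sigma> \<noteq> {}" "finite \<sigma>" "\<tau> \<noteq> {} \<Longrightarrow> \<tau> \<subseteq> \<sigma> \<Longrightarrow> \<tau> \<in> K"
  using assms unfolding abstract_simplicial_complex_def by blast+

text \<open>
  The sum over the support becomes a sum over a fixed finite set, which is what makes sums of points
  and continuity in the point accessible.
\<close>
lemma topspace_realization:
  assumes "finite V" "\<Union>K \<subseteq> V"
  shows "x \<in> topspace (realization K) \<longleftrightarrow> (\<forall>v. 0 \<le> x v) \<and> {v. x v \<noteq> 0} \<in> K \<and> sum x V = 1"
proof -
  have "sum x {v. x v \<noteq> 0} = sum x V" if "{v. x v \<noteq> 0} \<in> K"
    using that assms by (intro sum.mono_neutral_left) auto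
  then show ?thesis
    by (auto simp: realization_def)
qed

lemma realizationD:
  assumes "x \<in> topspace (realization K)"
  shows "0 \<le> x v" "{v. x v \<noteq> 0} \<in> K"
  using assms by (auto simp: realization_def)

lemma sum_realization:
  assumes "x \<in> topspace (realization K)" "finite V" "\<Union>K \<subseteq> V"
  shows "sum x V = 1"
  using topspace_realization[OF assms(2,3)] assms(1) by blast

lemma realization_zero_outside:
  assumes "x \<in> topspace (realization K)" "v \<notin> \<Union>K"
  shows "x v = 0"
  using realizationD(2)[OF assms(1)] assms(2) by auto

lemma continuous_map_into_realization:
  "continuous_map T (realization K) f \<longleftrightarrow>
    (\<forall>v. continuous_map T euclideanreal (\<lambda>x. f x v)) \<and> f ` topspace T \<subseteq> topspace (realization K)"
  by (auto simp: realization_def continuous_map_in_subtopology continuous_map_componentwise_UNIV)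

lemma continuous_map_realization_coordinate:
  "continuous_map (realization K) euclideanreal (\<lambda>x. x v)"
  using continuous_map_into_realization[of "realization K" K "\<lambda>x. x"] by simp

text \<open>
  On the straight line from \<open>f x\<close> to \<open>g x\<close> the support stays inside the union of the two supports;
  if this union is a face, the line does not leave the realization.
\<close>
lemma homotopic_contiguous_maps:
  assumes K: "abstract_simplicial_complex K" "finite (\<Union>K)"
    and f: "continuous_map X (realization K) f" and g: "continuous_map X (realization K) g"
    and contig: "\<And>x. x \<in> topspace X \<Longrightarrow> {v. f x v \<noteq> 0} \<union> {v. g x v \<noteq> 0} \<in> K"
  shows "homotopic_with (\<lambda>_. True) X (realization K) f g"
proof -
  define h where "h = (\<lambda>(t::real, x) v. (1 - t) * f x v + t * g x v)"
  let ?IX = "prod_topology (top_of_set {0..1}) X"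
  have mem: "h (t, x) \<in> topspace (realization K)" if t: "t \<in> {0..1}" and x: "x \<in> topspace X" for t x
  proof -
    have fx: "f x \<in> topspace (realization K)" and gx: "g x \<in> topspace (realization K)"
      using f g x by (auto simp: continuous_map_def)
    have nonneg: "0 \<le> h (t, x) v" for v
      using t realizationD(1)[OF fx] realizationD(1)[OF gx] by (simp add: h_def)
    have sum: "sum (h (t, x)) (\<Union>K) = 1"
      using sum_realization[OF fx K(2)] sum_realization[OF gx K(2)]
      by (simp add: h_def sum.distrib flip: sum_distrib_left)
    have "{v. h (t, x) v \<noteq> 0} \<subseteq> {v. f x v \<noteq> 0} \<union> {v. g x v \<noteq> 0}"
      by (auto simp: h_def)
    moreover have "{v. h (t, x) v \<noteq> 0} \<noteq> {}"
    proof
      assume "{v. h (t, x) v \<noteq> 0} = {}"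
      then have "sum (h (t, x)) (\<Union>K) = 0"
        by simp
      then show False
        using sum by simp
    qed
    ultimately have "{v. h (t, x) v \<noteq> 0} \<in> K"
      by (intro abstract_simplicial_complexD(3)[OF K(1) contig[OF x]])
    then show ?thesis
      using topspace_realization[OF K(2) subset_refl] nonneg sum by blast
  qed
  have coord: "continuous_map ?IX euclideanreal (\<lambda>p. k (snd p) v)"
    if "continuous_map X (realization K) k" for k v
    using that continuous_map_compose[OF continuous_map_snd, of X euclideanreal "\<lambda>x. k x v"]
    by (auto simp: continuous_map_into_realization o_def)
  have fst: "continuous_map ?IX euclideanreal fst"
    using continuous_map_fst continuous_map_into_fulltopology by blast
  have "continuous_map ?IX (realization K) h"
    unfolding continuous_map_into_realization
  proof (intro conjI allI)
    show "continuous_map ?IX euclideanreal (\<lambda>p. h p v)" for v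
      unfolding h_def case_prod_beta
      by (intro continuous_intros coord f g fst) auto
    show "h ` topspace ?IX \<subseteq> topspace (realization K)"
      using mem by auto
  qed
  moreover have "h (0, x) = f x" "h (1, x) = g x" for x
    by (auto simp: h_def)
  ultimately show ?thesis
    unfolding homotopic_with_def by blast
qed

text \<open>
  The affine extension of the vertex map \<open>\<phi>\<close> in barycentric coordinates.
\<close>
definition push_forward :: "'a set \<Rightarrow> ('a \<Rightarrow> 'b) \<Rightarrow> ('a \<Rightarrow> real) \<Rightarrow> 'b \<Rightarrow> real"
  where "push_forward V \<phi> x w = (\<Sum>v | v \<in> V \<and> \<phi> v = w. x v)"

lemma support_push_forward:
  assumes "finite (\<Union>K)" "x \<in> topspace (realization K)"
  shows "{w. push_forward (\<Union>K) \<phi> x w \<noteq> 0} = \<phi> ` {v. x v \<noteq> 0}"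
proof -
  have "push_forward (\<Union>K) \<phi> x w = 0 \<longleftrightarrow> (\<forall>v\<in>\<Union>K. \<phi> v = w \<longrightarrow> x v = 0)" for w
    unfolding push_forward_def using realizationD(1)[OF assms(2)] assms(1)
    by (subst sum_nonneg_eq_0_iff) (auto simp del: Union_iff)
  moreover have "v \<in> \<Union>K" if "x v \<noteq> 0" for v
    using realization_zero_outside[OF assms(2)] that by metis
  ultimately show ?thesis
    by (simp add: set_eq_iff image_iff) metis
qed

lemma continuous_map_push_forward:
  assumes K: "finite (\<Union>K)" and L: "finite (\<Union>L)" and \<phi>: "\<And>\<sigma>. \<sigma> \<in> K \<Longrightarrow> \<phi> ` \<sigma> \<in> L"
  shows "continuous_map (realization K) (realization L) (push_forward (\<Union>K) \<phi>)"
  unfolding continuous_map_into_realization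
proof (intro conjI allI image_subsetI)
  show "continuous_map (realization K) euclideanreal (\<lambda>x. push_forward (\<Union>K) \<phi> x w)" for w
    unfolding push_forward_def using K
    by (intro continuous_map_sum continuous_map_realization_coordinate) (simp del: Union_iff)
next
  fix x assume x: "x \<in> topspace (realization K)"
  have "{w. push_forward (\<Union>K) \<phi> x w \<noteq> 0} = \<phi> ` {v. x v \<noteq> 0}"
    by (rule support_push_forward[OF K x])
  then have "{w. push_forward (\<Union>K) \<phi> x w \<noteq> 0} \<in> L"
    using \<phi>[OF realizationD(2)[OF x]] by simp
  moreover have "sum (push_forward (\<Union>K) \<phi> x) (\<Union>L) = sum x (\<Union>K)"
    unfolding push_forward_def using \<phi> by (intro sum.group K L) blast
  then have "sum (push_forward (\<Union>K) \<phi> x) (\<Union>L) = 1"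
    using sum_realization[OF x K] by simp
  moreover have "0 \<le> push_forward (\<Union>K) \<phi> x w" for w
    unfolding push_forward_def by (intro sum_nonneg realizationD(1)[OF x])
  ultimately show "push_forward (\<Union>K) \<phi> x \<in> topspace (realization L)"
    using topspace_realization[OF L subset_refl] by blast
qed

text \<open>
  Simplicial maps that are mutually inverse up to contiguity: the induced maps have
  \<open>\<psi> ` \<phi> ` \<sigma>\<close> as support over a point with support \<open>\<sigma>\<close>, so straight lines connect the composites with
  the identities.
\<close>
lemma homotopy_equivalent_realizations:
  assumes K: "abstract_simplicial_complex K" "finite (\<Union>K)"
    and L: "abstract_simplicial_complex L" "finite (\<Union>L)"
    and \<phi>: "\<And>\<sigma>. \<sigma> \<in> K \<Longrightarrow> \<phi> ` \<sigma> \<in> L" and \<psi>: "\<And>\<tau>. \<tau> \<in> L \<Longrightarrow> \<psi> ` \<tau> \<in> K"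
    and \<psi>\<phi>: "\<And>\<sigma>. \<sigma> \<in> K \<Longrightarrow> \<psi> ` \<phi> ` \<sigma> \<union> \<sigma> \<in> K"
    and \<phi>\<psi>: "\<And>\<tau>. \<tau> \<in> L \<Longrightarrow> \<phi> ` \<psi> ` \<tau> \<union> \<tau> \<in> L"
  shows "realization K homotopy_equivalent_space realization L"
proof -
  have *: "homotopic_with (\<lambda>_. True) (realization A) (realization A)
      (push_forward (\<Union>B) b \<circ> push_forward (\<Union>A) a) id"
    if A: "abstract_simplicial_complex A" "finite (\<Union>A)" and B: "finite (\<Union>B)"
      and a: "\<And>\<sigma>. \<sigma> \<in> A \<Longrightarrow> a ` \<sigma> \<in> B" and b: "\<And>\<tau>. \<tau> \<in> B \<Longrightarrow> b ` \<tau> \<in> A"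
      and ba: "\<And>\<sigma>. \<sigma> \<in> A \<Longrightarrow> b ` a ` \<sigma> \<union> \<sigma> \<in> A"
    for A :: "'x set set" and B :: "'y set set" and a b
  proof (rule homotopic_contiguous_maps[OF A])
    note ca = continuous_map_push_forward[OF A(2) B a] and cb = continuous_map_push_forward[OF B A(2) b]
    show "continuous_map (realization A) (realization A) (push_forward (\<Union>B) b \<circ> push_forward (\<Union>A) a)"
      using ca cb by (rule continuous_map_compose)
    fix x assume x: "x \<in> topspace (realization A)"
    let ?y = "push_forward (\<Union>A) a x"
    have y: "?y \<in> topspace (realization B)"
      using ca x by (auto simp: continuous_map_def)
    have "{v. push_forward (\<Union>B) b ?y v \<noteq> 0} = b ` a ` {v. x v \<noteq> 0}"
      by (simp only: support_push_forward[OF B y] support_push_forward[OF A(2) x])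
    then show "{v. (push_forward (\<Union>B) b \<circ> push_forward (\<Union>A) a) x v \<noteq> 0} \<union> {v. id x v \<noteq> 0} \<in> A"
      using ba[OF realizationD(2)[OF x]] by simp
  qed auto
  show ?thesis
    unfolding homotopy_equivalent_space_def
    using continuous_map_push_forward[OF K(2) L(2) \<phi>] continuous_map_push_forward[OF L(2) K(2) \<psi>]
      *[OF K L(2) \<phi> \<psi> \<psi>\<phi>] *[OF L K(2) \<psi> \<phi> \<phi>\<psi>]
    by blast
qed

lemma complex_isomorphic_imp_homotopy_equivalent:
  assumes K: "abstract_simplicial_complex K" "finite (\<Union>K)"
    and L: "abstract_simplicial_complex L" "finite (\<Union>L)"
    and iso: "complex_isomorphic K L"
  shows "realization K homotopy_equivalent_space realization L"
proof -
  obtain f where f: "bij_betw f (\<Union>K) (\<Union>L)" and face: "\<And>\<sigma>. \<sigma> \<subseteq> \<Union>K \<Longrightarrow> \<sigma> \<in> K \<longleftrightarrow> f ` \<sigma> \<in> L"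
    using iso by (auto simp: complex_isomorphic_def complex_verts_def)
  let ?g = "inv_into (\<Union>K) f"
  have gf: "?g ` f ` \<sigma> = \<sigma>" if "\<sigma> \<in> K" for \<sigma>
    using that f by (auto simp: bij_betw_def intro!: inv_into_image_cancel)
  have fg: "f ` ?g ` \<tau> = \<tau>" if "\<tau> \<in> L" for \<tau>
    using that f by (metis Union_upper bij_betw_def image_inv_into_cancel)
  have fK: "f ` \<sigma> \<in> L" if "\<sigma> \<in> K" for \<sigma>
    using that face by blast
  have gL: "?g ` \<tau> \<in> K" if "\<tau> \<in> L" for \<tau>
  proof -
    have "\<tau> \<subseteq> f ` \<Union>K"
      using f that by (auto simp: bij_betw_def)
    then have "?g ` \<tau> \<subseteq> \<Union>K"
      by (metis image_subsetI inv_into_into subset_eq)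
    then show ?thesis
      using face fg[OF that] that by metis
  qed
  show ?thesis
    by (rule homotopy_equivalent_realizations[OF K L, of f ?g]) (auto simp: fK gL gf fg)
qed

lemma complex_isomorphic_image:
  assumes "inj_on c (\<Union>L)"
  shows "complex_isomorphic ((`) c ` L) L"
proof -
  let ?K = "(`) c ` L"
  let ?f = "inv_into (\<Union>L) c"
  have UK: "\<Union>?K = c ` \<Union>L"
    by auto
  have bij: "bij_betw ?f (\<Union>?K) (\<Union>L)"
    unfolding UK using assms by (intro bij_betw_inv_into) (simp add: bij_betw_def)
  have "\<sigma> \<in> ?K \<longleftrightarrow> ?f ` \<sigma> \<in> L" if "\<sigma> \<subseteq> \<Union>?K" for \<sigma>
  proof
    assume "\<sigma> \<in> ?K"
    then obtain \<tau> where \<tau>: "\<tau> \<in> L" "\<sigma> = c ` \<tau>"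
      by blast
    then have "?f ` \<sigma> = \<tau>"
      using inv_into_image_cancel[OF assms, of \<tau>] by blast
    then show "?f ` \<sigma> \<in> L"
      using \<tau> by simp
  next
    assume "?f ` \<sigma> \<in> L"
    moreover have "c ` ?f ` \<sigma> = \<sigma>"
      using that unfolding UK by (rule image_inv_into_cancel[OF refl])
    ultimately show "\<sigma> \<in> ?K"
      by (metis imageI)
  qed
  then show ?thesis
    unfolding complex_isomorphic_def complex_verts_def using bij by blast
qed

text \<open>
  The realization is the union of the finitely many closed simplices \<open>F \<sigma>\<close>, each of which is closed
  in a product of compact intervals and singletons.
\<close>
lemma compact_space_realization:
  assumes "abstract_simplicial_complex K" "finite (\<Union>K)"
  shows "compact_space (realization K)"
proof -
  define F where
    "F \<sigma> = (\<Pi>\<^sub>E v\<in>UNIV. if v \<in> \<sigma> then {0..1} else {0::real}) \<inter> {x. sum x \<sigma> = 1}" for \<sigma> :: "'a set"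
  have F: "F \<sigma> = {x. (\<forall>v. 0 \<le> x v) \<and> {v. x v \<noteq> 0} \<subseteq> \<sigma> \<and> sum x \<sigma> = 1}" if "\<sigma> \<in> K" for \<sigma>
  proof -
    have "finite \<sigma>"
      using abstract_simplicial_complexD(2)[OF assms(1) that] .
    then have "x v \<le> 1" if "\<forall>v. 0 \<le> x v" "sum x \<sigma> = 1" "v \<in> \<sigma>" for x :: "'a \<Rightarrow> real" and v
      using that member_le_sum[of v \<sigma> x] by simp
    moreover have "x \<in> (\<Pi>\<^sub>E v\<in>UNIV. if v \<in> \<sigma> then {0..1} else {0::real}) \<longleftrightarrow>
        (\<forall>v. 0 \<le> x v) \<and> {v. x v \<noteq> 0} \<subseteq> \<sigma> \<and> (\<forall>v\<in>\<sigma>. x v \<le> 1)" for x :: "'a \<Rightarrow> real"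
      by (auto simp: PiE_UNIV_domain Pi_iff split: if_splits) (metis order_refl)
    ultimately show ?thesis
      unfolding F_def set_eq_iff Int_iff mem_Collect_eq by blast
  qed
  have "compactin (powertop_real UNIV) (F \<sigma>)" for \<sigma>
  proof -
    have "compactin (powertop_real UNIV) (\<Pi>\<^sub>E v\<in>UNIV. if v \<in> \<sigma> then {0..1} else {0::real})"
      unfolding compactin_PiE by auto
    moreover have "closedin (powertop_real UNIV) {x. sum x \<sigma> = 1}"
    proof -
      have "continuous_on UNIV (\<lambda>x::'a \<Rightarrow> real. sum x \<sigma>)"
        by (intro continuous_on_sum continuous_on_product_coordinates)
      then show ?thesis
        by (simp add: euclidean_product_topology closed_Collect_eq)
    qed
    ultimately show ?thesis
      unfolding F_def by (rule compact_Int_closedin)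
  qed
  moreover have "finite K"
    using assms(2) by (rule finite_UnionD)
  ultimately have "compactin (powertop_real UNIV) (\<Union>(F ` K))"
    by (intro compactin_Union) auto
  moreover have "\<Union>(F ` K) = {x. (\<forall>v. 0 \<le> x v) \<and> {v. x v \<noteq> 0} \<in> K \<and> (\<Sum>v | x v \<noteq> 0. x v) = 1}"
    (is "_ = ?S")
  proof (intro set_eqI iffI)
    fix x assume "x \<in> \<Union>(F ` K)"
    then obtain \<sigma> where \<sigma>: "\<sigma> \<in> K" and x: "\<forall>v. 0 \<le> x v" "{v. x v \<noteq> 0} \<subseteq> \<sigma>" "sum x \<sigma> = 1"
      using F by auto
    have "sum x {v. x v \<noteq> 0} = sum x \<sigma>"
      using abstract_simplicial_complexD(2)[OF assms(1) \<sigma>] x(2) by (intro sum.mono_neutral_left) auto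
    moreover have "{v. x v \<noteq> 0} \<noteq> {}"
    proof
      assume "{v. x v \<noteq> 0} = {}"
      then have "sum x \<sigma> = 0"
        by simp
      then show False
        using x(3) by simp
    qed
    ultimately show "x \<in> ?S"
      using abstract_simplicial_complexD(3)[OF assms(1) \<sigma> _ x(2)] x by simp
  next
    fix x assume "x \<in> ?S"
    then show "x \<in> \<Union>(F ` K)"
      using F by auto
  qed
  ultimately show ?thesis
    unfolding realization_def by (simp add: compact_space_subtopology)
qed

lemma Hausdorff_space_realization: "Hausdorff_space (realization K)"
  unfolding realization_def by (simp add: Hausdorff_space_subtopology Hausdorff_space_product_topology)

section \<open>Disjoint unions\<close>

lemma abstract_simplicial_complex_disjoint_union:
  assumes "abstract_simplicial_complex K" "abstract_simplicial_complex L"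
  shows "abstract_simplicial_complex (complex_disjoint_union K L)"
  unfolding abstract_simplicial_complex_def
proof (intro conjI ballI allI impI)
  fix \<sigma> assume \<sigma>: "\<sigma> \<in> complex_disjoint_union K L"
  then show "finite \<sigma>" "\<sigma> \<noteq> {}"
    using assms by (auto simp: complex_disjoint_union_def abstract_simplicial_complex_def)
  fix \<tau> assume \<tau>: "\<tau> \<noteq> {} \<and> \<tau> \<subseteq> \<sigma>"
  from \<sigma> consider \<rho> where "\<rho> \<in> K" "\<sigma> = Inl ` \<rho>" | \<rho> where "\<rho> \<in> L" "\<sigma> = Inr ` \<rho>"
    unfolding complex_disjoint_union_def by blast
  then show "\<tau> \<in> complex_disjoint_union K L"
  proof cases
    case (1 \<rho>)
    then obtain \<tau>' where "\<tau>' \<subseteq> \<rho>" "\<tau> = Inl ` \<tau>'"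
      using \<tau> by (meson subset_image_iff)
    then show ?thesis
      using \<tau> abstract_simplicial_complexD(3)[OF assms(1) 1(1)] by (auto simp: complex_disjoint_union_def)
  next
    case (2 \<rho>)
    then obtain \<tau>' where "\<tau>' \<subseteq> \<rho>" "\<tau> = Inr ` \<tau>'"
      using \<tau> by (meson subset_image_iff)
    then show ?thesis
      using \<tau> abstract_simplicial_complexD(3)[OF assms(2) 2(1)] by (auto simp: complex_disjoint_union_def)
  qed
qed

lemma finite_disjoint_union:
  assumes "finite (\<Union>K)" "finite (\<Union>L)"
  shows "finite (\<Union>(complex_disjoint_union K L))"
proof (rule finite_subset)
  show "\<Union>(complex_disjoint_union K L) \<subseteq> \<Union>K <+> \<Union>L"
    unfolding complex_disjoint_union_def by auto
  show "finite (\<Union>K <+> \<Union>L)"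
    using assms by (rule finite_Plus)
qed

lemma abstract_simplicial_complex_simplex: "abstract_simplicial_complex (simplex_complex m)"
  by (auto simp: abstract_simplicial_complex_def simplex_complex_def intro: finite_subset)

lemma finite_simplex: "finite (\<Union>(simplex_complex m))"
  by (rule finite_subset[of _ "{0..m}"]) (auto simp: simplex_complex_def)

lemma continuous_map_from_sum_topology:
  "continuous_map (sum_topology X I) Y f \<longleftrightarrow> (\<forall>i\<in>I. continuous_map (X i) Y (\<lambda>x. f (i, x)))"
  (is "?L \<longleftrightarrow> ?R")
proof
  assume ?L
  then show ?R
    using continuous_map_compose[OF continuous_map_component_injection] by (fastforce simp: o_def)
next
  assume R: ?R
  have "openin (X i) {x. (i, x) \<in> Sigma I (topspace \<circ> X) \<and> f (i, x) \<in> U}" if "i \<in> I" "openin Y U" for i U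
    using R that by (simp add: continuous_map_def)
  then show ?L
    using R by (force simp: continuous_map_def openin_sum_topology Pi_iff)
qed

text \<open>
  The point of a one-vertex complex has the single coordinate \<open>1\<close>.  The evident continuous bijection
  is a homeomorphism because its source is compact and its target Hausdorff.
\<close>
lemma disjoint_point_homeomorphic:
  assumes K: "abstract_simplicial_complex K" "finite (\<Union>K)"
  shows "disjoint_point (realization K) homeomorphic_space
    realization (complex_disjoint_union K (simplex_complex 0))"
proof -
  define D where "D = complex_disjoint_union K (simplex_complex 0)"
  have D: "\<sigma> \<in> D \<longleftrightarrow> (\<exists>\<tau>\<in>K. \<sigma> = Inl ` \<tau>) \<or> \<sigma> = {Inr 0}" for \<sigma> :: "('a + nat) set"
    by (auto simp: D_def complex_disjoint_union_def simplex_complex_def)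
  have UD: "\<Union>D = \<Union>K <+> {0}"
    unfolding D_def complex_disjoint_union_def simplex_complex_def by auto
  have finD: "finite (\<Union>D)"
    unfolding UD by (rule finite_Plus[OF K(2)]) simp
  define h :: "bool \<times> ('a \<Rightarrow> real) \<Rightarrow> 'a + nat \<Rightarrow> real"
    where "h = (\<lambda>(b, x) w. case w of Inl v \<Rightarrow> if b then x v else 0 | Inr i \<Rightarrow> if \<not> b \<and> i = 0 then 1 else 0)"
  let ?T = "disjoint_point (realization K)"
  have topT: "topspace ?T = {True} \<times> topspace (realization K) \<union> {(False, undefined)}"
    by (auto simp: disjoint_point_def split: if_splits)
  have supp_True: "{w. h (True, x) w \<noteq> 0} = Inl ` {v. x v \<noteq> 0}" for x
  proof (rule set_eqI)
    show "w \<in> {w. h (True, x) w \<noteq> 0} \<longleftrightarrow> w \<in> Inl ` {v. x v \<noteq> 0}" for w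
      by (cases w) (auto simp: h_def)
  qed
  have supp_False: "{w. h (False, x) w \<noteq> 0} = {Inr 0}" for x
  proof (rule set_eqI)
    show "w \<in> {w. h (False, x) w \<noteq> 0} \<longleftrightarrow> w \<in> {Inr 0}" for w
      by (cases w) (auto simp: h_def)
  qed
  have h_True: "h (True, x) \<in> topspace (realization D)" if x: "x \<in> topspace (realization K)" for x
  proof -
    have "sum (h (True, x)) (\<Union>D) = 1"
      unfolding UD using K(2) sum_realization[OF x K(2)] by (simp add: sum.Plus h_def o_def)
    moreover have "0 \<le> h (True, x) w" for w
      using realizationD(1)[OF x] by (auto simp: h_def split: sum.splits)
    ultimately show ?thesis
      unfolding topspace_realization[OF finD subset_refl] supp_True
      using realizationD(2)[OF x] by (auto simp: D)
  qed
  have h_False: "h (False, x) \<in> topspace (realization D)" for x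
  proof -
    have "sum (h (False, x)) (\<Union>D) = 1"
      unfolding UD using K(2) by (simp add: sum.Plus h_def o_def)
    moreover have "0 \<le> h (False, x) w" for w
      by (auto simp: h_def split: sum.splits)
    ultimately show ?thesis
      unfolding topspace_realization[OF finD subset_refl] supp_False by (auto simp: D)
  qed
  have cont: "continuous_map ?T (realization D) h"
    unfolding disjoint_point_def continuous_map_from_sum_topology
  proof (intro ballI)
    fix b :: bool
    have "continuous_map (realization K) euclideanreal (\<lambda>x. h (True, x) w)" for w
      by (cases w) (auto simp: h_def continuous_map_realization_coordinate)
    then show "continuous_map (if b then realization K else discrete_topology {undefined}) (realization D) (\<lambda>x. h (b, x))"
      using h_True h_False by (cases b) (auto simp: continuous_map_into_realization)
  qed
  have comp: "compact_space ?T"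
  proof -
    have "compactin ?T ((\<lambda>x. (True, x)) ` topspace (realization K))"
    proof (rule image_compactin)
      show "compactin (realization K) (topspace (realization K))"
        using compact_space_realization[OF K] by (simp add: compact_space_def)
      show "continuous_map (realization K) ?T (\<lambda>x. (True, x))"
        unfolding disjoint_point_def
        using continuous_map_component_injection[of True UNIV "\<lambda>b. if b then realization K else discrete_topology {undefined}"]
        by simp
    qed
    moreover have "compactin ?T {(False, undefined)}"
      by (simp add: topT)
    ultimately have "compactin ?T ((\<lambda>x. (True, x)) ` topspace (realization K) \<union> {(False, undefined)})"
      by (rule compactin_Un)
    moreover have "(\<lambda>x. (True, x)) ` topspace (realization K) \<union> {(False, undefined)} = topspace ?T"
      unfolding topT by auto
    ultimately show ?thesis
      by (simp add: compact_space_def)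
  qed
  have surj: "topspace (realization D) \<subseteq> h ` topspace ?T"
  proof
    fix y assume y: "y \<in> topspace (realization D)"
    have sum: "(\<Sum>v\<in>\<Union>K. y (Inl v)) + y (Inr 0) = 1"
      using sum_realization[OF y finD subset_refl] K(2) unfolding UD by (simp add: sum.Plus o_def)
    from realizationD(2)[OF y] consider \<tau> where "\<tau> \<in> K" "{w. y w \<noteq> 0} = Inl ` \<tau>" | "{w. y w \<noteq> 0} = {Inr 0}"
      unfolding D by blast
    then show "y \<in> h ` topspace ?T"
    proof cases
      case 1
      then have *: "{v. y (Inl v) \<noteq> 0} = \<tau>" "y (Inr i) = 0" for i
        by (auto simp: set_eq_iff)
      then have "y \<circ> Inl \<in> topspace (realization K)"
        using topspace_realization[OF K(2) subset_refl] realizationD(1)[OF y] sum 1(1) by (simp add: o_def)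
      moreover have "h (True, y \<circ> Inl) = y"
        using * by (auto simp: h_def fun_eq_iff split: sum.splits)
      ultimately show ?thesis
        unfolding topT by (metis SigmaI UnCI imageI singletonI)
    next
      case 2
      then have *: "y w = 0" if "w \<noteq> Inr 0" for w
        using that by blast
      then have "y (Inr 0) = 1"
        using sum by simp
      then have "h (False, undefined) = y"
        using * by (auto simp: h_def fun_eq_iff split: sum.splits)
      then show ?thesis
        unfolding topT by (metis UnCI imageI singletonI)
    qed
  qed
  have inj: "inj_on h (topspace ?T)"
  proof (rule inj_onI)
    fix p q assume p: "p \<in> topspace ?T" "q \<in> topspace ?T" and eq: "h p = h q"
    have layer: "fst p = fst q"
      using fun_cong[OF eq, of "Inr 0"] by (cases p, cases q) (simp add: h_def split: if_splits)
    have "snd p v = snd q v" if "fst p" for v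
      using fun_cong[OF eq, of "Inl v"] layer that by (cases p, cases q) (simp add: h_def)
    then have "snd p = snd q" if "fst p"
      using that by blast
    then show "p = q"
      using p layer unfolding topT by (auto simp: prod_eq_iff)
  qed
  have "h ` topspace ?T = topspace (realization D)"
    using surj h_True h_False unfolding topT by blast
  then have "homeomorphic_map ?T (realization D) h"
    by (intro continuous_imp_homeomorphic_map cont comp Hausdorff_space_realization inj)
  then show ?thesis
    unfolding D_def by (rule homeomorphic_map_imp_homeomorphic_space)
qed

section \<open>Suspensions\<close>

text \<open>
  The quotient is compact, being the image of \<open>X\<close>, so the continuous bijection that \<open>h\<close> induces on it is
  a homeomorphism.
\<close>
lemma quotient_topology_homeomorphic:
  assumes r: "equiv (topspace X) r" and X: "compact_space X" and Y: "Hausdorff_space Y"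
    and h: "continuous_map X Y h" "h ` topspace X = topspace Y"
    and ker: "\<And>x y. x \<in> topspace X \<Longrightarrow> y \<in> topspace X \<Longrightarrow> h x = h y \<longleftrightarrow> (x, y) \<in> r"
  shows "quotient_topology X r homeomorphic_space Y"
proof -
  let ?Q = "quotient_topology X r"
  have sub: "U \<subseteq> topspace X // r" if "openin ?Q U" for U
    using that openin_quotient_topology[OF r] by blast
  have union: "\<Union>U = {x \<in> topspace X. r `` {x} \<in> U}" if "U \<subseteq> topspace X // r" for U
  proof (intro set_eqI iffI)
    fix x assume "x \<in> \<Union>U"
    then obtain A where A: "A \<in> U" "x \<in> A" by blast
    then have "A \<in> topspace X // r"
      using that by blast
    then obtain y where y: "y \<in> topspace X" "A = r `` {y}"
      by (rule quotientE)
    then have "x \<in> topspace X" "A = r `` {x}"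
      using A(2) equiv_type[OF r] equiv_class_eq[OF r] by auto
    then show "x \<in> {x \<in> topspace X. r `` {x} \<in> U}"
      using A by simp
  next
    fix x assume "x \<in> {x \<in> topspace X. r `` {x} \<in> U}"
    then show "x \<in> \<Union>U"
      using equiv_class_self[OF r] by blast
  qed
  have "openin ?Q (topspace X // r)"
    unfolding openin_quotient_topology[OF r] Union_quotient[OF r] by simp
  then have topQ: "topspace ?Q = topspace X // r"
    using sub by (meson openin_subset openin_topspace subset_antisym)
  have proj: "continuous_map X ?Q (\<lambda>x. r `` {x})"
    unfolding continuous_map_def topQ
    using union sub openin_quotient_topology[OF r] by (auto intro: quotientI)
  have "compactin ?Q ((\<lambda>x. r `` {x}) ` topspace X)"
    using X proj by (auto simp: compact_space_def intro: image_compactin)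
  moreover have "(\<lambda>x. r `` {x}) ` topspace X = topspace ?Q"
    unfolding topQ quotient_def by auto
  ultimately have comp: "compact_space ?Q"
    by (simp add: compact_space_def)
  define H where "H A = h (SOME x. x \<in> A)" for A
  have H: "H (r `` {x}) = h x" if "x \<in> topspace X" for x
  proof -
    have "(SOME y. y \<in> r `` {x}) \<in> r `` {x}"
      using equiv_class_self[OF r that] by (rule someI)
    then show ?thesis
      unfolding H_def using ker[of x] that equiv_type[OF r] by (metis Image_singleton_iff SigmaE2 subsetD)
  qed
  have cont: "continuous_map ?Q Y H"
    unfolding continuous_map_def
  proof (intro conjI allI impI)
    show "H \<in> topspace ?Q \<rightarrow> topspace Y"
      using H h(2) by (auto simp: topQ quotient_def)
    fix W assume "openin Y W"
    then have "openin X {x \<in> topspace X. h x \<in> W}"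
      using h(1) by (simp add: continuous_map_def)
    moreover have "\<Union>{A \<in> topspace ?Q. H A \<in> W} = {x \<in> topspace X. h x \<in> W}"
      using H by (subst union) (auto simp: topQ intro: quotientI)
    ultimately show "openin ?Q {A \<in> topspace ?Q. H A \<in> W}"
      unfolding openin_quotient_topology[OF r] by (auto simp: topQ)
  qed
  have surj: "H ` topspace ?Q = topspace Y"
  proof -
    have "topspace ?Q = (\<lambda>x. r `` {x}) ` topspace X"
      unfolding topQ quotient_def by auto
    then have "H ` topspace ?Q = h ` topspace X"
      using H by (simp add: image_image)
    then show ?thesis
      using h(2) by simp
  qed
  have inj: "inj_on H (topspace ?Q)"
  proof (rule inj_onI)
    fix A B assume A: "A \<in> topspace ?Q" and B: "B \<in> topspace ?Q" and eq: "H A = H B"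
    obtain x where x: "x \<in> topspace X" "A = r `` {x}"
      using A unfolding topQ by (rule quotientE)
    obtain y where y: "y \<in> topspace X" "B = r `` {y}"
      using B unfolding topQ by (rule quotientE)
    have "(x, y) \<in> r"
      using eq ker x y H by simp
    then show "A = B"
      using x y equiv_class_eq[OF r] by simp
  qed
  show ?thesis
    using continuous_imp_homeomorphic_map[OF cont comp Y surj inj] homeomorphic_map_imp_homeomorphic_space
    by blast
qed

text \<open>
  The join of \<open>K\<close> with two points: a face may contain at most one of the poles \<open>Inr False\<close> and
  \<open>Inr True\<close>, and its remaining vertices form a possibly empty face of \<open>K\<close>.
\<close>
definition suspension_complex :: "'a set set \<Rightarrow> ('a + bool) set set"
  where "suspension_complex K =
    {\<sigma>. \<sigma> \<noteq> {} \<and> Inl -` \<sigma> \<in> insert {} K \<and> (Inr False \<notin> \<sigma> \<or> Inr True \<notin> \<sigma>)}"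

lemma insert_empty_closed:
  assumes "abstract_simplicial_complex K" "\<sigma> \<in> insert {} K" "\<tau> \<subseteq> \<sigma>"
  shows "\<tau> \<in> insert {} K"
  using assms abstract_simplicial_complexD(3)[OF assms(1)] by blast

lemma finite_vimage_sum:
  fixes \<sigma> :: "('a + bool) set"
  assumes "finite (Inl -` \<sigma>)"
  shows "finite \<sigma>"
proof (rule finite_subset)
  show "\<sigma> \<subseteq> Inl -` \<sigma> <+> UNIV"
  proof
    fix w assume "w \<in> \<sigma>"
    then show "w \<in> Inl -` \<sigma> <+> UNIV"
      by (cases w) auto
  qed
qed (use assms in simp)

lemma abstract_simplicial_complex_suspension:
  assumes K: "abstract_simplicial_complex K"
  shows "abstract_simplicial_complex (suspension_complex K)"
  unfolding abstract_simplicial_complex_def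
proof (intro conjI ballI allI impI)
  fix \<sigma> assume \<sigma>: "\<sigma> \<in> suspension_complex K"
  then show "\<sigma> \<noteq> {}"
    by (simp add: suspension_complex_def)
  show "finite \<sigma>"
    using \<sigma> abstract_simplicial_complexD(2)[OF K]
    by (intro finite_vimage_sum) (auto simp: suspension_complex_def)
  fix \<tau> assume \<tau>: "\<tau> \<noteq> {} \<and> \<tau> \<subseteq> \<sigma>"
  then have "Inl -` \<tau> \<subseteq> Inl -` \<sigma>"
    by (simp add: vimage_mono)
  moreover have "Inl -` \<sigma> \<in> insert {} K"
    using \<sigma> by (simp add: suspension_complex_def)
  ultimately have "Inl -` \<tau> \<in> insert {} K"
    using insert_empty_closed[OF K] by blast
  then show "\<tau> \<in> suspension_complex K"
    using \<sigma> \<tau> by (auto simp: suspension_complex_def)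
qed

lemma Union_suspension_complex_subset: "\<Union>(suspension_complex K) \<subseteq> \<Union>K <+> UNIV"
proof
  fix w assume "w \<in> \<Union>(suspension_complex K)"
  then show "w \<in> \<Union>K <+> UNIV"
    by (cases w) (auto simp: suspension_complex_def)
qed

lemma sum_Plus_bool:
  fixes y :: "'a + bool \<Rightarrow> real"
  assumes "finite V"
  shows "sum y (V <+> UNIV) = (\<Sum>v\<in>V. y (Inl v)) + y (Inr False) + y (Inr True)"
  using assms by (simp add: sum.Plus UNIV_bool)

lemma topspace_realization_suspension:
  assumes "finite (\<Union>K)"
  shows "y \<in> topspace (realization (suspension_complex K)) \<longleftrightarrow>
    (\<forall>w. 0 \<le> y w) \<and> {v. y (Inl v) \<noteq> 0} \<in> insert {} K \<and> (y (Inr False) = 0 \<or> y (Inr True) = 0) \<and>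
    (\<Sum>v\<in>\<Union>K. y (Inl v)) + y (Inr False) + y (Inr True) = 1"
proof -
  have "{w. y w \<noteq> 0} \<noteq> {}" if "(\<Sum>v\<in>\<Union>K. y (Inl v)) + y (Inr False) + y (Inr True) = 1"
  proof
    assume "{w. y w \<noteq> 0} = {}"
    then have "y w = 0" for w
      by simp
    then show False
      using that by simp
  qed
  moreover have "finite (\<Union>K <+> (UNIV :: bool set))"
    by (rule finite_Plus[OF assms finite])
  ultimately show ?thesis
    unfolding topspace_realization[OF \<open>finite (\<Union>K <+> UNIV)\<close> Union_suspension_complex_subset] sum_Plus_bool[OF assms]
    by (auto simp: suspension_complex_def)
qed

text \<open>
  The level \<open>1/2\<close> of the suspension corresponds to \<open>K\<close> itself.  Moving away from it transfers the
  weight \<open>\<bar>2 s - 1\<bar>\<close> from \<open>K\<close> to the pole that is approached, so that exactly the two end levels are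
  collapsed.
\<close>
lemma suspension_homeomorphic:
  assumes asc: "abstract_simplicial_complex K" and K: "finite (\<Union>K)" "K \<noteq> {}"
  shows "suspension (realization K) homeomorphic_space realization (suspension_complex K)"
proof -
  define C where "C = prod_topology (realization K) (top_of_set {0..1::real})"
  let ?S = "realization (suspension_complex K)"
  define h :: "('a \<Rightarrow> real) \<times> real \<Rightarrow> 'a + bool \<Rightarrow> real"
    where "h = (\<lambda>(x, s) w. case w of Inl v \<Rightarrow> (1 - \<bar>2 * s - 1\<bar>) * x v
      | Inr b \<Rightarrow> if b then max 0 (2 * s - 1) else max 0 (1 - 2 * s))"
  have h_simps: "h (x, s) (Inl v) = (1 - \<bar>2 * s - 1\<bar>) * x v"
    "h (x, s) (Inr False) = max 0 (1 - 2 * s)" "h (x, s) (Inr True) = max 0 (2 * s - 1)" for x s v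
    by (auto simp: h_def)
  have topC: "topspace C = topspace (realization K) \<times> {0..1}"
    by (simp add: C_def)
  have mem: "h (x, s) \<in> topspace ?S" if x: "x \<in> topspace (realization K)" and s: "s \<in> {0..1}" for x s
    unfolding topspace_realization_suspension[OF K(1)]
  proof (intro conjI allI)
    show "0 \<le> h (x, s) w" for w
      using realizationD(1)[OF x] s by (auto simp: h_def split: sum.splits intro!: mult_nonneg_nonneg)
    show "{v. h (x, s) (Inl v) \<noteq> 0} \<in> insert {} K"
      by (rule insert_empty_closed[OF asc, of "{v. x v \<noteq> 0}"]) (use realizationD(2)[OF x] in \<open>auto simp: h_simps\<close>)
    show "h (x, s) (Inr False) = 0 \<or> h (x, s) (Inr True) = 0"
      by (auto simp: h_simps)
    show "(\<Sum>v\<in>\<Union>K. h (x, s) (Inl v)) + h (x, s) (Inr False) + h (x, s) (Inr True) = 1"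
      using sum_realization[OF x K(1) subset_refl] by (simp add: h_simps flip: sum_distrib_left)
  qed
  have cont: "continuous_map C ?S h"
    unfolding continuous_map_into_realization
  proof (intro conjI allI)
    have fst: "continuous_map C euclideanreal (\<lambda>p. fst p v)" for v
      using continuous_map_compose[OF continuous_map_fst continuous_map_realization_coordinate, of _ _ v]
      by (simp add: C_def o_def)
    have snd: "continuous_map C euclideanreal snd"
      unfolding C_def using continuous_map_snd continuous_map_into_fulltopology by blast
    show "continuous_map C euclideanreal (\<lambda>p. h p w)" for w
    proof (cases w)
      case (Inl v)
      then show ?thesis
        unfolding h_def case_prod_beta by simp (intro continuous_intros fst snd; simp)
    next
      case (Inr b)
      then show ?thesis
        unfolding h_def case_prod_beta by (cases b) (simp, intro continuous_intros fst snd; simp)+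
    qed
    show "h ` topspace C \<subseteq> topspace ?S"
      using mem by (auto simp: topC)
  qed
  have surj: "topspace ?S \<subseteq> h ` topspace C"
  proof
    fix y assume "y \<in> topspace ?S"
    note y' = this[unfolded topspace_realization_suspension[OF K(1)]]
    have y: "\<And>w. 0 \<le> y w" "{v. y (Inl v) \<noteq> 0} \<in> insert {} K" "y (Inr False) = 0 \<or> y (Inr True) = 0"
      and sum: "(\<Sum>v\<in>\<Union>K. y (Inl v)) + y (Inr False) + y (Inr True) = 1"
      using y' by simp_all
    define \<Sigma> where "\<Sigma> = (\<Sum>v\<in>\<Union>K. y (Inl v))"
    \<comment> \<open>One of the pole weights vanishes, so their difference determines the level.\<close>
    define s where "s = (1 - y (Inr False) + y (Inr True)) / 2"
    have \<Sigma>: "0 \<le> \<Sigma>"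
      unfolding \<Sigma>_def using y(1) by (simp add: sum_nonneg)
    have s: "s \<in> {0..1}" "1 - \<bar>2 * s - 1\<bar> = \<Sigma>" "max 0 (1 - 2 * s) = y (Inr False)" "max 0 (2 * s - 1) = y (Inr True)"
      using y(1)[of "Inr False"] y(1)[of "Inr True"] y(3) sum \<Sigma> unfolding \<Sigma>_def[symmetric] s_def
      by (auto simp: max_def abs_if field_simps)
    have zero: "y (Inl v) = 0" if "v \<notin> \<Union>K" for v
      using y(2) that by blast
    have "\<exists>x\<in>topspace (realization K). \<forall>v. \<Sigma> * x v = y (Inl v)"
    proof (cases "\<Sigma> = 0")
      case True
      \<comment> \<open>At a pole the point of \<open>K\<close> is arbitrary; this is where \<open>K\<close> must be nonempty.\<close>
      obtain \<sigma> where \<sigma>: "\<sigma> \<in> K"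
        using K(2) by blast
      then obtain v where v: "v \<in> \<sigma>"
        using abstract_simplicial_complexD(1)[OF asc] by blast
      then have "{v} \<in> K" "v \<in> \<Union>K"
        using \<sigma> abstract_simplicial_complexD(3)[OF asc \<sigma>] by auto
      then have "(\<lambda>u. if u = v then 1 else 0) \<in> topspace (realization K)"
        using K(1) by (simp add: topspace_realization[OF K(1) subset_refl] del: Union_iff)
      moreover have "y (Inl u) = 0" for u
      proof (cases "u \<in> \<Union>K")
        case False
        then show ?thesis by (rule zero)
      next
        case u: True
        have "y (Inl u) \<le> \<Sigma>"
          unfolding \<Sigma>_def using u K(1) y(1) by (intro member_le_sum)
        then show ?thesis
          using True y(1)[of "Inl u"] by simp
      qed
      ultimately show ?thesis
        using True by auto
    next
      case False
      have "{v. y (Inl v) \<noteq> 0} \<noteq> {}"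
        using False unfolding \<Sigma>_def by (auto intro: sum.neutral)
      then have "{v. y (Inl v) / \<Sigma> \<noteq> 0} \<in> K"
        using y(2) False by auto
      moreover have "(\<Sum>v\<in>\<Union>K. y (Inl v) / \<Sigma>) = 1"
        using False by (simp add: \<Sigma>_def flip: sum_divide_distrib)
      ultimately have "(\<lambda>v. y (Inl v) / \<Sigma>) \<in> topspace (realization K)"
        using y(1) \<Sigma> unfolding topspace_realization[OF K(1) subset_refl] by auto
      then show ?thesis
        using False by (intro bexI[of _ "\<lambda>v. y (Inl v) / \<Sigma>"]) auto
    qed
    then obtain x where x: "x \<in> topspace (realization K)" "\<And>v. \<Sigma> * x v = y (Inl v)"
      by blast
    have "h (x, s) = y"
    proof
      fix w show "h (x, s) w = y w"
      proof (cases w)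
        case (Inl v)
        then show ?thesis by (simp add: h_simps s x)
      next
        case (Inr b)
        then show ?thesis by (cases b) (simp_all add: h_simps s)
      qed
    qed
    then show "y \<in> h ` topspace C"
      using x s topC by force
  qed
  have ker: "h p = h q \<longleftrightarrow> (p, q) \<in> merge_layers (topspace C) {0, 1}"
    if p: "p \<in> topspace C" and q: "q \<in> topspace C" for p q
  proof -
    obtain x s where ps: "p = (x, s)" by fastforce
    obtain y t where qt: "q = (y, t)" by fastforce
    have s: "0 \<le> s" "s \<le> 1"
      using p ps by (auto simp: topC)
    show ?thesis
    proof
      assume eq: "h p = h q"
      have "max 0 (1 - 2 * s) = max 0 (1 - 2 * t)" "max 0 (2 * s - 1) = max 0 (2 * t - 1)"
        using fun_cong[OF eq, of "Inr False"] fun_cong[OF eq, of "Inr True"] by (simp_all add: ps qt h_simps)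
      then have st: "s = t"
        by (auto simp: max_def split: if_splits)
      have "x = y" if "s \<noteq> 0" "s \<noteq> 1"
      proof
        fix v
        have "1 - \<bar>2 * s - 1\<bar> \<noteq> 0"
          using that s by (auto simp: abs_if)
        then show "x v = y v"
          using fun_cong[OF eq, of "Inl v"] by (simp add: ps qt h_simps flip: st)
      qed
      then show "(p, q) \<in> merge_layers (topspace C) {0, 1}"
        using p q st by (auto simp: merge_layers_def ps qt)
    next
      assume "(p, q) \<in> merge_layers (topspace C) {0, 1}"
      then consider "p = q" | "s = t" "s = 0 \<or> s = 1"
        by (auto simp: merge_layers_def ps qt)
      then show "h p = h q"
        by cases (auto simp: ps qt h_def fun_eq_iff split: sum.splits)
    qed
  qed
  have "compact_space C"
    unfolding C_def using compact_space_realization[OF asc K(1)] by (simp add: compact_space_prod_topology compact_space_subtopology)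
  moreover have "h ` topspace C = topspace ?S"
    using surj mem unfolding topC by blast
  ultimately have "quotient_topology C (merge_layers (topspace C) {0, 1}) homeomorphic_space ?S"
    using cont ker Hausdorff_space_realization
    by (intro quotient_topology_homeomorphic equiv_merge_layers)
  then show ?thesis
    by (simp add: suspension_def C_def Let_def)
qed

section \<open>Cones whose base is filled by a simplex\<close>

lemma continuous_map_Min:
  assumes "finite I" "I \<noteq> {}" "\<And>i. i \<in> I \<Longrightarrow> continuous_map X euclideanreal (f i)"
  shows "continuous_map X euclideanreal (\<lambda>x. Min ((\<lambda>i. f i x) ` I))"
  using assms
proof (induction I rule: finite_ne_induct)
  case (singleton i)
  then show ?case by (simp add: eta_contract_eq)
next
  case (insert i I)
  then show ?case by (simp add: continuous_map_real_min)
qed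

text \<open>
  The least weight that \<open>x\<close> puts outside a face of \<open>K\<close>.  For a point of the full simplex on the
  vertices of \<open>K\<close> it measures how far \<open>x\<close> is from the subcomplex \<open>K\<close>.
\<close>
definition escaping_mass :: "'a set set \<Rightarrow> ('a \<Rightarrow> real) \<Rightarrow> real"
  where "escaping_mass K x = Min ((\<lambda>\<tau>. sum x (\<Union>K - \<tau>)) ` K)"

context
  fixes K :: "'a set set"
  assumes K: "abstract_simplicial_complex K" "finite (\<Union>K)" "K \<noteq> {}"
begin

lemma finite_complex: "finite K"
  using K(2) by (rule finite_UnionD)

lemma escaping_mass_attained:
  obtains \<tau> where "\<tau> \<in> K" "escaping_mass K x = sum x (\<Union>K - \<tau>)"
proof -
  have "escaping_mass K x \<in> (\<lambda>\<tau>. sum x (\<Union>K - \<tau>)) ` K"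
    unfolding escaping_mass_def using finite_complex K(3) by (intro Min_in) auto
  then show ?thesis
    using that by blast
qed

lemma escaping_mass_le: "\<tau> \<in> K \<Longrightarrow> escaping_mass K x \<le> sum x (\<Union>K - \<tau>)"
  unfolding escaping_mass_def using finite_complex by (intro Min_le) auto

lemma escaping_mass_nonneg: "(\<And>v. 0 \<le> x v) \<Longrightarrow> 0 \<le> escaping_mass K x"
  by (metis escaping_mass_attained sum_nonneg)

lemma escaping_mass_ge_vertex:
  assumes "\<And>v. 0 \<le> x v" "\<tau> \<in> K" "escaping_mass K x = sum x (\<Union>K - \<tau>)" "v \<in> \<Union>K - \<tau>"
  shows "x v \<le> escaping_mass K x"
  unfolding assms(3) using assms(1,4) K(2) by (intro member_le_sum finite_Diff)

text \<open>
  If the minimum is attained at the face \<open>\<tau>\<close>, every vertex outside \<open>\<tau>\<close> has at most the total weight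
  outside \<open>\<tau>\<close>, hence does not survive the truncation.
\<close>
lemma truncated_support:
  assumes "\<And>v. 0 \<le> x v"
  shows "{v \<in> \<Union>K. escaping_mass K x < x v} \<in> insert {} K"
proof -
  obtain \<tau> where \<tau>: "\<tau> \<in> K" "escaping_mass K x = sum x (\<Union>K - \<tau>)"
    by (rule escaping_mass_attained)
  show ?thesis
  proof (rule insert_empty_closed[OF K(1)])
    show "{v \<in> \<Union>K. escaping_mass K x < x v} \<subseteq> \<tau>"
      using escaping_mass_ge_vertex[OF assms \<tau>] by force
  qed (use \<tau> in simp)
qed

lemma escaping_mass_zero:
  assumes "\<And>v. 0 \<le> x v" "{v. x v \<noteq> 0} \<in> insert {} K"
  shows "escaping_mass K x = 0"
proof -
  obtain \<tau> where \<tau>: "\<tau> \<in> K" "{v. x v \<noteq> 0} \<subseteq> \<tau>"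
    using assms(2) K(3) by blast
  have "sum x (\<Union>K - \<tau>) = 0"
    using \<tau>(2) by (intro sum.neutral) auto
  then show ?thesis
    using escaping_mass_le[OF \<tau>(1), of x] escaping_mass_nonneg[of x] assms(1) by simp
qed

lemma continuous_map_escaping_mass:
  assumes "\<And>v. continuous_map X euclideanreal (\<lambda>x. f x v)"
  shows "continuous_map X euclideanreal (\<lambda>x. escaping_mass K (f x))"
  unfolding escaping_mass_def
  by (intro continuous_map_Min finite_complex K(3) continuous_map_sum assms finite_Diff K(2))

end

text \<open>
  The union of the full simplex on the vertices of \<open>K\<close> with the cone over \<open>K\<close>.  The apex of the cone is
  \<open>Inr True\<close>.  The type is that of \<open>suspension_complex\<close>, whose pole \<open>Inr False\<close> is replaced by the
  simplex and is not a vertex here.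
\<close>
definition cone_with_simplex :: "'a set set \<Rightarrow> ('a + bool) set set"
  where "cone_with_simplex K =
    {\<sigma>. \<sigma> \<noteq> {} \<and> (\<sigma> \<subseteq> Inl ` \<Union>K \<or> Inl -` \<sigma> \<in> insert {} K \<and> Inr False \<notin> \<sigma>)}"

lemma abstract_simplicial_complex_cone_with_simplex:
  assumes K: "abstract_simplicial_complex K" "finite (\<Union>K)"
  shows "abstract_simplicial_complex (cone_with_simplex K)"
  unfolding abstract_simplicial_complex_def
proof (intro conjI ballI allI impI)
  fix \<sigma> assume \<sigma>: "\<sigma> \<in> cone_with_simplex K"
  then show "\<sigma> \<noteq> {}"
    by (simp add: cone_with_simplex_def)
  show "finite \<sigma>"
  proof (rule finite_vimage_sum)
    have "Inl -` \<sigma> \<subseteq> \<Union>K"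
      using \<sigma> unfolding cone_with_simplex_def by auto
    then show "finite (Inl -` \<sigma>)"
      using K(2) by (rule finite_subset)
  qed
  fix \<tau> assume \<tau>: "\<tau> \<noteq> {} \<and> \<tau> \<subseteq> \<sigma>"
  have "Inl -` \<tau> \<in> insert {} K" if "Inl -` \<sigma> \<in> insert {} K"
    using \<tau> by (intro insert_empty_closed[OF K(1) that] vimage_mono) simp
  then show "\<tau> \<in> cone_with_simplex K"
    using \<sigma> \<tau> unfolding cone_with_simplex_def mem_Collect_eq by (meson subset_trans subsetD)
qed

lemma Union_cone_with_simplex_subset: "\<Union>(cone_with_simplex K) \<subseteq> \<Union>K <+> UNIV"
proof
  fix w assume "w \<in> \<Union>(cone_with_simplex K)"
  then show "w \<in> \<Union>K <+> UNIV"
    by (cases w) (auto simp: cone_with_simplex_def)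
qed

lemma topspace_realization_cone_with_simplex:
  assumes "finite (\<Union>K)"
  shows "y \<in> topspace (realization (cone_with_simplex K)) \<longleftrightarrow>
    (\<forall>w. 0 \<le> y w) \<and> y (Inr False) = 0 \<and> {v. y (Inl v) \<noteq> 0} \<subseteq> \<Union>K \<and>
    (y (Inr True) = 0 \<or> {v. y (Inl v) \<noteq> 0} \<in> insert {} K) \<and>
    (\<Sum>v\<in>\<Union>K. y (Inl v)) + y (Inr True) = 1"
proof -
  have 1: "{w. y w \<noteq> 0} \<noteq> {}" if "(\<Sum>v\<in>\<Union>K. y (Inl v)) + y (Inr True) = 1"
  proof
    assume "{w. y w \<noteq> 0} = {}"
    then have "y w = 0" for w
      by simp
    then show False
      using that by simp
  qed
  have 2: "{w. y w \<noteq> 0} \<subseteq> Inl ` \<Union>K \<longleftrightarrow>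
      y (Inr False) = 0 \<and> y (Inr True) = 0 \<and> {v. y (Inl v) \<noteq> 0} \<subseteq> \<Union>K" (is "?l \<longleftrightarrow> ?r")
  proof
    assume ?l
    then have "y w \<noteq> 0 \<Longrightarrow> w \<in> Inl ` \<Union>K" for w
      by blast
    from this[of "Inr False"] this[of "Inr True"] this[of "Inl v" for v] show ?r
      by (simp add: subset_iff inj_image_mem_iff image_iff del: Union_iff) blast
  next
    assume r: ?r
    show ?l
    proof
      fix w assume w: "w \<in> {w. y w \<noteq> 0}"
      show "w \<in> Inl ` \<Union>K"
      proof (cases w)
        case (Inl v)
        then show ?thesis using r w by auto
      next
        case (Inr b)
        then show ?thesis using r w by (cases b) auto
      qed
    qed
  qed
  have "{v. y (Inl v) \<noteq> 0} \<in> insert {} K \<Longrightarrow> {v. y (Inl v) \<noteq> 0} \<subseteq> \<Union>K"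
    by blast
  then have 3: "{w. y w \<noteq> 0} \<in> cone_with_simplex K \<longleftrightarrow> {w. y w \<noteq> 0} \<noteq> {} \<and>
    y (Inr False) = 0 \<and> {v. y (Inl v) \<noteq> 0} \<subseteq> \<Union>K \<and>
    (y (Inr True) = 0 \<or> {v. y (Inl v) \<noteq> 0} \<in> insert {} K)"
    unfolding cone_with_simplex_def mem_Collect_eq 2 vimage_Collect_eq by blast
  have fin: "finite (\<Union>K <+> (UNIV :: bool set))"
    by (rule finite_Plus[OF assms finite])
  show ?thesis
    unfolding topspace_realization[OF fin Union_cone_with_simplex_subset] sum_Plus_bool[OF assms] 3
    using 1 by auto
qed

text \<open>
  The map \<open>f\<close> spreads the weight of the pole \<open>Inr False\<close> evenly over the vertices of \<open>K\<close>.  The map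
  \<open>g\<close> truncates at the escaping mass \<open>\<rho>\<close>, gives the weight \<open>\<rho>\<close> to the pole, and rescales.  On the cone
  over \<open>K\<close> the escaping mass vanishes, so \<open>g\<close> does nothing there and the apex is never combined with the pole.
\<close>
lemma cone_with_simplex_homotopy_equivalent_suspension_complex:
  assumes K: "abstract_simplicial_complex K" "finite (\<Union>K)" "K \<noteq> {}"
  shows "realization (cone_with_simplex K) homotopy_equivalent_space realization (suspension_complex K)"
proof -
  let ?C = "realization (cone_with_simplex K)" and ?S = "realization (suspension_complex K)"
  note topC = topspace_realization_cone_with_simplex[OF K(2)]
    and topS = topspace_realization_suspension[OF K(2)]
  define n where "n = card (\<Union>K)"
  obtain \<sigma>\<^sub>0 where "\<sigma>\<^sub>0 \<in> K"
    using K(3) by blast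
  then have "\<Union>K \<noteq> {}"
    using abstract_simplicial_complexD(1)[OF K(1)] by blast
  then have n: "n > 0"
    using K(2) by (simp add: n_def card_gt_0_iff)
  define f :: "('a + bool \<Rightarrow> real) \<Rightarrow> 'a + bool \<Rightarrow> real"
    where "f y w = (case w of Inl v \<Rightarrow> if v \<in> \<Union>K then y (Inl v) + y (Inr False) / n else 0
      | Inr b \<Rightarrow> if b then y (Inr True) else 0)" for y w
  define \<rho> :: "('a + bool \<Rightarrow> real) \<Rightarrow> real" where "\<rho> y = escaping_mass K (\<lambda>v. y (Inl v))" for y
  define g\<^sub>0 :: "('a + bool \<Rightarrow> real) \<Rightarrow> 'a + bool \<Rightarrow> real"
    where "g\<^sub>0 y w = (case w of Inl v \<Rightarrow> max 0 (y (Inl v) - \<rho> y)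
      | Inr b \<Rightarrow> if b then y (Inr True) else \<rho> y)" for y w
  define mass where "mass y = (\<Sum>v\<in>\<Union>K. g\<^sub>0 y (Inl v)) + g\<^sub>0 y (Inr False) + g\<^sub>0 y (Inr True)" for y
  define g where "g y w = g\<^sub>0 y w / mass y" for y w
  have f_simps: "v \<in> \<Union>K \<Longrightarrow> f y (Inl v) = y (Inl v) + y (Inr False) / n"
    "v \<notin> \<Union>K \<Longrightarrow> f y (Inl v) = 0" "f y (Inr True) = y (Inr True)" "f y (Inr False) = 0" for y v
    by (simp_all add: f_def del: Union_iff)
  have g\<^sub>0_simps: "g\<^sub>0 y (Inl v) = max 0 (y (Inl v) - \<rho> y)" "g\<^sub>0 y (Inr True) = y (Inr True)"
    "g\<^sub>0 y (Inr False) = \<rho> y" for y v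
    by (simp_all add: g\<^sub>0_def)
  have f_mem: "f y \<in> topspace ?C" if "y \<in> topspace ?S" for y
  proof -
    have y: "\<And>w. 0 \<le> y w" "{v. y (Inl v) \<noteq> 0} \<in> insert {} K" "y (Inr False) = 0 \<or> y (Inr True) = 0"
      and sum: "(\<Sum>v\<in>\<Union>K. y (Inl v)) + y (Inr False) + y (Inr True) = 1"
      using that[unfolded topS] by simp_all
    show ?thesis
      unfolding topC
    proof (intro conjI allI)
      show "0 \<le> f y w" for w
        using y(1) by (auto simp: f_def split: sum.splits)
      show "f y (Inr False) = 0"
        by (simp add: f_simps)
      show "{v. f y (Inl v) \<noteq> 0} \<subseteq> \<Union>K"
        using f_simps(2) by blast
      show "f y (Inr True) = 0 \<or> {v. f y (Inl v) \<noteq> 0} \<in> insert {} K"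
      proof (cases "y (Inr True) = 0")
        case False
        then have "{v. f y (Inl v) \<noteq> 0} \<subseteq> {v. y (Inl v) \<noteq> 0}"
          using y(3) by (auto simp: f_def)
        then show ?thesis
          using insert_empty_closed[OF K(1) y(2)] by blast
      qed (simp add: f_simps)
      have "(\<Sum>v\<in>\<Union>K. f y (Inl v)) = (\<Sum>v\<in>\<Union>K. y (Inl v) + y (Inr False) / n)"
        by (intro sum.cong refl f_simps)
      also have "\<dots> = (\<Sum>v\<in>\<Union>K. y (Inl v)) + y (Inr False)"
        using n by (simp add: sum.distrib n_def)
      finally show "(\<Sum>v\<in>\<Union>K. f y (Inl v)) + f y (Inr True) = 1"
        using sum by (simp add: f_simps)
    qed
  qed
  have \<rho>_zero: "\<rho> y = 0" if "\<And>w. 0 \<le> y w" "{v. y (Inl v) \<noteq> 0} \<in> insert {} K" for y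
    unfolding \<rho>_def using that by (intro escaping_mass_zero[OF K]) auto
  have mass_pos: "0 < mass y" and \<rho>_nonneg: "0 \<le> \<rho> y" and g_supp: "{v. g y (Inl v) \<noteq> 0} = {v \<in> \<Union>K. \<rho> y < y (Inl v)}"
    and g_mem: "g y \<in> topspace ?S" if "y \<in> topspace ?C" for y
  proof -
    have y: "\<And>w. 0 \<le> y w" "y (Inr False) = 0" "{v. y (Inl v) \<noteq> 0} \<subseteq> \<Union>K"
        "y (Inr True) = 0 \<or> {v. y (Inl v) \<noteq> 0} \<in> insert {} K"
      and sum: "(\<Sum>v\<in>\<Union>K. y (Inl v)) + y (Inr True) = 1"
      using that[unfolded topC] by simp_all
    show \<rho>: "0 \<le> \<rho> y"
      unfolding \<rho>_def using y(1) by (intro escaping_mass_nonneg[OF K])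
    have g\<^sub>0: "0 \<le> g\<^sub>0 y w" for w
      using y(1) \<rho> by (auto simp: g\<^sub>0_def split: sum.splits)
    show pos: "0 < mass y"
    proof (cases "\<rho> y = 0")
      case True
      then show ?thesis
        using sum y(1) by (simp add: mass_def g\<^sub>0_simps)
    next
      case False
      then show ?thesis
        unfolding mass_def using \<rho> g\<^sub>0 y(1)[of "Inr True"] g\<^sub>0_simps(2,3)[of y]
        by (smt (verit) sum_nonneg)
    qed
    show supp: "{v. g y (Inl v) \<noteq> 0} = {v \<in> \<Union>K. \<rho> y < y (Inl v)}"
      using pos \<rho> y(3) by (auto simp: g_def g\<^sub>0_simps max_def simp del: Union_iff split: if_splits)
    show "g y \<in> topspace ?S"
      unfolding topS
    proof (intro conjI allI)
      show "0 \<le> g y w" for w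
        unfolding g_def using pos g\<^sub>0 by simp
      show "{v. g y (Inl v) \<noteq> 0} \<in> insert {} K"
        unfolding supp \<rho>_def using y(1) by (intro truncated_support[OF K])
      show "g y (Inr False) = 0 \<or> g y (Inr True) = 0"
        using y(4) \<rho>_zero[OF y(1)] by (auto simp: g_def g\<^sub>0_simps)
      have "(\<Sum>v\<in>\<Union>K. g y (Inl v)) + g y (Inr False) + g y (Inr True) = mass y / mass y"
        by (simp only: g_def mass_def flip: sum_divide_distrib add_divide_distrib)
      then show "(\<Sum>v\<in>\<Union>K. g y (Inl v)) + g y (Inr False) + g y (Inr True) = 1"
        using pos by simp
    qed
  qed
  have f_cont: "continuous_map ?S ?C f"
    unfolding continuous_map_into_realization
  proof (intro conjI allI)
    note coord = continuous_map_realization_coordinate[of "suspension_complex K"]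
    have shift: "continuous_map ?S euclideanreal (\<lambda>y. y (Inl v) + y (Inr False) / n)" for v
      using n by (intro continuous_intros coord) auto
    show "continuous_map ?S euclideanreal (\<lambda>y. f y w)" for w
      unfolding f_def using shift coord by (cases w) simp_all
    show "f ` topspace ?S \<subseteq> topspace ?C"
      using f_mem by blast
  qed
  have g_cont: "continuous_map ?C ?S g"
    unfolding continuous_map_into_realization
  proof (intro conjI allI)
    note coord = continuous_map_realization_coordinate[of "cone_with_simplex K"]
    have \<rho>: "continuous_map ?C euclideanreal \<rho>"
      unfolding \<rho>_def by (intro continuous_map_escaping_mass[OF K] coord)
    have trunc: "continuous_map ?C euclideanreal (\<lambda>y. max 0 (y (Inl v) - \<rho> y))" for v
      by (intro continuous_map_real_max continuous_map_diff coord \<rho>) simp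
    have g\<^sub>0: "continuous_map ?C euclideanreal (\<lambda>y. g\<^sub>0 y w)" for w
      unfolding g\<^sub>0_def using trunc coord \<rho> by (cases w) simp_all
    show "continuous_map ?C euclideanreal (\<lambda>y. g y w)" for w
      unfolding g_def mass_def
      by (intro continuous_map_real_divide continuous_map_add continuous_map_sum K(2) g\<^sub>0)
        (use mass_pos in \<open>force simp: mass_def\<close>)
    show "g ` topspace ?C \<subseteq> topspace ?S"
      using g_mem by blast
  qed
  have gf: "homotopic_with (\<lambda>_. True) ?S ?S (g \<circ> f) id"
  proof (rule homotopic_contiguous_maps)
    show "abstract_simplicial_complex (suspension_complex K)"
      by (rule abstract_simplicial_complex_suspension[OF K(1)])
    show "finite (\<Union>(suspension_complex K))"
      using Union_suspension_complex_subset by (rule finite_subset) (rule finite_Plus[OF K(2) finite])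
    show "continuous_map ?S ?S (g \<circ> f)"
      using f_cont g_cont by (rule continuous_map_compose)
    fix y assume y\<^sub>S: "y \<in> topspace ?S"
    have y: "\<And>w. 0 \<le> y w" "{v. y (Inl v) \<noteq> 0} \<in> insert {} K" "y (Inr False) = 0 \<or> y (Inr True) = 0"
      using y\<^sub>S[unfolded topS] by simp_all
    have f0: "0 \<le> f y w" for w
      using f_mem[OF y\<^sub>S, unfolded topC] by simp
    let ?supp = "{w. (g \<circ> f) y w \<noteq> 0} \<union> {w. id y w \<noteq> 0}"
    \<comment> \<open>Truncating at the height that \<open>f\<close> added, or above it, leaves only vertices of \<open>y\<close>.\<close>
    have "{v \<in> \<Union>K. \<rho> (f y) < f y (Inl v)} \<union> {v. y (Inl v) \<noteq> 0} \<in> insert {} K"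
    proof (cases "\<rho> (f y) < y (Inr False) / n")
      case False
      then have "{v \<in> \<Union>K. \<rho> (f y) < f y (Inl v)} \<subseteq> {v. y (Inl v) \<noteq> 0}"
        using f_simps(1) by fastforce
      then show ?thesis
        using y(2) by (simp add: Un_absorb1)
    next
      case True
      \<comment> \<open>A vertex outside the optimal face would carry at least the added height, so there is
        none, and \<open>K\<close> is a full simplex.\<close>
      obtain \<tau> where \<tau>: "\<tau> \<in> K" "escaping_mass K (\<lambda>v. f y (Inl v)) = (\<Sum>v\<in>\<Union>K - \<tau>. f y (Inl v))"
        by (rule escaping_mass_attained[OF K])
      have K_sub: "\<Union>K \<subseteq> \<tau>"
      proof
        fix v assume v: "v \<in> \<Union>K"
        show "v \<in> \<tau>"
        proof (rule ccontr)
          assume "v \<notin> \<tau>"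
          then have "f y (Inl v) \<le> \<rho> (f y)"
            unfolding \<rho>_def using v f0 by (intro escaping_mass_ge_vertex[OF K _ \<tau>]) auto
          then show False
            using True y(1)[of "Inl v"] f_simps(1)[OF v, of y] by simp
        qed
      qed
      have "{v. y (Inl v) \<noteq> 0} \<subseteq> \<Union>K"
        using y(2) by blast
      then have "{v \<in> \<Union>K. \<rho> (f y) < f y (Inl v)} \<union> {v. y (Inl v) \<noteq> 0} \<subseteq> \<tau>"
        by (intro Un_least order_trans[OF Collect_subset] order_trans[OF _ K_sub]) (rule order_refl)
      then show ?thesis
        by (rule insert_empty_closed[OF K(1) insertI2[OF \<tau>(1)]])
    qed
    moreover have "Inl -` ?supp = {v \<in> \<Union>K. \<rho> (f y) < f y (Inl v)} \<union> {v. y (Inl v) \<noteq> 0}"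
      using g_supp[OF f_mem[OF y\<^sub>S]] by auto
    ultimately have "Inl -` ?supp \<in> insert {} K"
      by simp
    moreover have "Inr False \<notin> ?supp \<or> Inr True \<notin> ?supp"
    proof (cases "y (Inr True) = 0")
      case True
      then show ?thesis
        by (simp add: g_def g\<^sub>0_simps f_simps)
    next
      case False
      then have "y (Inr False) = 0"
        using y(3) by simp
      moreover have "\<rho> (f y) = 0"
        using f_mem[OF y\<^sub>S, unfolded topC] False by (intro \<rho>_zero f0) (simp add: f_simps)
      ultimately show ?thesis
        by (simp add: g_def g\<^sub>0_simps)
    qed
    moreover have "?supp \<noteq> {}"
      using realizationD(2)[OF y\<^sub>S] by (auto simp: suspension_complex_def)
    ultimately show "?supp \<in> suspension_complex K"
      unfolding suspension_complex_def by blast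
  qed simp
  have fg: "homotopic_with (\<lambda>_. True) ?C ?C (f \<circ> g) id"
  proof (rule homotopic_contiguous_maps)
    show "abstract_simplicial_complex (cone_with_simplex K)"
      by (rule abstract_simplicial_complex_cone_with_simplex[OF K(1,2)])
    show "finite (\<Union>(cone_with_simplex K))"
      using Union_cone_with_simplex_subset by (rule finite_subset) (rule finite_Plus[OF K(2) finite])
    show "continuous_map ?C ?C (f \<circ> g)"
      using g_cont f_cont by (rule continuous_map_compose)
    fix y assume y\<^sub>C: "y \<in> topspace ?C"
    have y: "\<And>w. 0 \<le> y w" "y (Inr False) = 0" "{v. y (Inl v) \<noteq> 0} \<subseteq> \<Union>K"
        "y (Inr True) = 0 \<or> {v. y (Inl v) \<noteq> 0} \<in> insert {} K"
      using y\<^sub>C[unfolded topC] by simp_all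
    let ?supp = "{w. (f \<circ> g) y w \<noteq> 0} \<union> {w. id y w \<noteq> 0}"
    have supp: "{w. y w \<noteq> 0} \<in> cone_with_simplex K"
      by (rule realizationD(2)[OF y\<^sub>C])
    \<comment> \<open>Over the cone \<open>f \<circ> g\<close> creates no new vertices; elsewhere everything happens inside the
      simplex.\<close>
    show "?supp \<in> cone_with_simplex K"
    proof (cases "{v. y (Inl v) \<noteq> 0} \<in> insert {} K")
      case True
      then have \<rho>: "\<rho> y = 0"
        by (intro \<rho>_zero y(1))
      have "(f \<circ> g) y w = 0" if "y w = 0" for w
      proof (cases w)
        case (Inl v)
        then show ?thesis
          using that \<rho> by (simp add: f_def g_def g\<^sub>0_simps)
      next
        case (Inr b)
        then show ?thesis
          using that by (cases b) (simp_all add: f_simps g_def g\<^sub>0_simps)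
      qed
      then have "?supp = {w. y w \<noteq> 0}"
        by auto
      then show ?thesis
        using supp by simp
    next
      case False
      then have top: "y (Inr True) = 0"
        using y(4) by blast
      have "w \<in> Inl ` \<Union>K" if "w \<in> ?supp" for w
      proof (cases w)
        case (Inl v)
        have "v \<in> \<Union>K"
        proof (rule ccontr)
          assume v: "v \<notin> \<Union>K"
          then have "y (Inl v) = 0"
            using y(3) by blast
          then show False
            using that f_simps(2)[OF v] Inl by simp
        qed
        then show ?thesis
          using Inl by blast
      next
        case (Inr b)
        then show ?thesis
          using that top y(2) by (cases b) (simp_all add: f_simps g_def g\<^sub>0_simps)
      qed
      moreover have "?supp \<noteq> {}"
        using supp by (auto simp: cone_with_simplex_def)
      ultimately show ?thesis
        unfolding cone_with_simplex_def mem_Collect_eq by (intro conjI disjI1 subsetI)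
    qed
  qed simp
  show ?thesis
    unfolding homotopy_equivalent_space_def using f_cont g_cont fg gf by blast
qed

section \<open>Out-neighborhood complexes of the directed Mycielskians\<close>

text \<open>
  A class is an out-neighbor of the class of \<open>x\<close> iff it contains an out-neighbor of some
  representative.
\<close>
lemma out_nbhd_complex_quotient:
  assumes "pair_fin_digraph D" and r: "equiv (pverts D) r"
  shows "\<sigma> \<in> out_nbhd_complex (digraph_quotient D r) \<longleftrightarrow>
    \<sigma> \<noteq> {} \<and> (\<exists>x\<in>pverts D. \<sigma> \<subseteq> (\<lambda>y. r `` {y}) ` (\<Union>x'\<in>r `` {x}. out_nbhd D x'))"
proof -
  interpret pair_fin_digraph D by fact
  have "out_nbhd (digraph_quotient D r) A = (\<lambda>y. r `` {y}) ` (\<Union>x\<in>A. out_nbhd D x)"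
    if "A \<in> pverts D // r" for A
  proof (intro set_eqI iffI)
    fix B assume "B \<in> out_nbhd (digraph_quotient D r) A"
    then obtain x y where B: "B \<in> pverts D // r" and xy: "x \<in> A" "y \<in> B" "(x, y) \<in> parcs D"
      by (auto simp: out_nbhd_def digraph_quotient_def)
    obtain z where "z \<in> pverts D" "B = r `` {z}"
      using B by (rule quotientE)
    then have "B = r `` {y}"
      using xy(2) equiv_class_eq[OF r] by auto
    then show "B \<in> (\<lambda>y. r `` {y}) ` (\<Union>x\<in>A. out_nbhd D x)"
      using xy by (auto simp: out_nbhd_def)
  next
    fix B assume "B \<in> (\<lambda>y. r `` {y}) ` (\<Union>x\<in>A. out_nbhd D x)"
    then obtain x y where xy: "x \<in> A" "(x, y) \<in> parcs D" "B = r `` {y}"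
      by (auto simp: out_nbhd_def)
    then have "y \<in> pverts D"
      using wellformed' by blast
    then have "B \<in> pverts D // r" "y \<in> B"
      using xy(3) equiv_class_self[OF r] by (auto intro: quotientI)
    then show "B \<in> out_nbhd (digraph_quotient D r) A"
      using xy that by (auto simp: out_nbhd_def digraph_quotient_def)
  qed
  then show ?thesis
    unfolding out_nbhd_complex_def by (auto simp: digraph_quotient_def quotient_def)
qed

text \<open>
  The class of a vertex \<open>p\<close> of the product under \<open>merge_layers\<close>, in closed form.
\<close>
definition layer_class :: "'a pair_pre_digraph \<Rightarrow> 'b set \<Rightarrow> 'a \<times> 'b \<Rightarrow> ('a \<times> 'b) set"
  where "layer_class G S p = (if snd p \<in> S then pverts G \<times> {snd p} else {p})"

lemma out_nbhd_complex_merge_layers: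
  assumes G: "pair_fin_digraph G" and H: "pair_fin_digraph H"
  shows "\<sigma> \<in> out_nbhd_complex (digraph_quotient (digraph_prod G H) (merge_layers (pverts (digraph_prod G H)) S)) \<longleftrightarrow>
    \<sigma> \<noteq> {} \<and> (\<exists>g\<in>pverts G. \<exists>i\<in>pverts H. \<sigma> \<subseteq> layer_class G S `
      ((\<Union>h\<in>(if i \<in> S then pverts G else {g}). out_nbhd G h) \<times> out_nbhd H i))"
proof -
  interpret G: pair_fin_digraph G by fact
  interpret H: pair_fin_digraph H by fact
  let ?D = "digraph_prod G H" and ?r = "merge_layers (pverts (digraph_prod G H)) S"
  have verts: "pverts ?D = pverts G \<times> pverts H"
    by (simp add: digraph_prod_def)
  have cls: "?r `` {p} = layer_class G S p" if "p \<in> pverts ?D" for p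
    using that by (auto simp: merge_layers_def layer_class_def verts)
  have nbhd: "out_nbhd ?D (g, i) = out_nbhd G g \<times> out_nbhd H i" for g i
    by (auto simp: out_nbhd_def digraph_prod_def)
  have sub: "out_nbhd ?D p \<subseteq> pverts ?D" for p
    by (auto simp: out_nbhd_def digraph_prod_def dest: G.wellformed' H.wellformed')
  have "(\<lambda>y. ?r `` {y}) ` (\<Union>x'\<in>?r `` {(g, i)}. out_nbhd ?D x') =
      layer_class G S ` ((\<Union>h\<in>(if i \<in> S then pverts G else {g}). out_nbhd G h) \<times> out_nbhd H i)"
    if "g \<in> pverts G" "i \<in> pverts H" for g i
  proof -
    have "(\<Union>x'\<in>?r `` {(g, i)}. out_nbhd ?D x') =
        (\<Union>h\<in>(if i \<in> S then pverts G else {g}). out_nbhd G h) \<times> out_nbhd H i"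
      using that by (subst cls) (auto simp: verts layer_class_def nbhd)
    moreover have "(\<lambda>y. ?r `` {y}) ` (\<Union>x'\<in>?r `` {(g, i)}. out_nbhd ?D x') =
        layer_class G S ` (\<Union>x'\<in>?r `` {(g, i)}. out_nbhd ?D x')"
      using sub cls by (intro image_cong refl) blast
    ultimately show ?thesis
      by simp
  qed
  moreover have "(\<exists>x\<in>pverts G \<times> pverts H. P x) \<longleftrightarrow> (\<exists>g\<in>pverts G. \<exists>i\<in>pverts H. P (g, i))" for P
    by auto
  ultimately show ?thesis
    unfolding out_nbhd_complex_quotient[OF pair_fin_digraph_prod[OF G H] equiv_merge_layers]
    by (simp add: verts cong: bex_cong_simp)
qed

lemma pair_fin_digraph_I: "pair_fin_digraph I1" "pair_fin_digraph I2" "pair_fin_digraph I3"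
  by (unfold_locales; auto simp: I1_def I2_def I3_def)+

lemma pair_fin_digraph_mycielskian:
  assumes "pair_fin_digraph G"
  shows "pair_fin_digraph (mycielskian1 G)" "pair_fin_digraph (mycielskian2 G)" "pair_fin_digraph (mycielskian3 G)"
  unfolding mycielskian1_def mycielskian2_def mycielskian3_def
  by (intro pair_fin_digraph_quotient pair_fin_digraph_prod assms pair_fin_digraph_I equiv_merge_layers)+

lemma finite_out_nbhd_complex:
  assumes "pair_fin_digraph G"
  shows "finite (\<Union>(out_nbhd_complex G))"
proof -
  interpret pair_fin_digraph G by fact
  show ?thesis
    using complex_verts_out_nbhd_complex[OF assms] pair_finite_verts by (simp add: complex_verts_def)
qed

lemma Union_out_nbhd_complex: "\<Union>(out_nbhd_complex G) = (\<Union>h\<in>pverts G. out_nbhd G h)"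
  by (auto simp: out_nbhd_complex_def)

text \<open>
  Each of the three Mycielskians merges layer \<open>2\<close> into this vertex.  It becomes the isolated point of
  the first complex and the cone apex of the third.
\<close>
definition apex :: "'a pair_pre_digraph \<Rightarrow> ('a \<times> nat) set"
  where "apex G = pverts G \<times> {2}"

context
  fixes G :: "'a pair_pre_digraph"
  assumes G: "pair_fin_digraph G" and ne: "out_nbhd_complex G \<noteq> {}"
begin

lemma exists_out_nbhd: "\<exists>g\<in>pverts G. out_nbhd G g \<noteq> {}"
  using ne by (auto simp: out_nbhd_complex_def)

lemma out_nbhd_complex_mycielskian1:
  "\<sigma> \<in> out_nbhd_complex (mycielskian1 G) \<longleftrightarrow>
    \<sigma> = {apex G} \<or> \<sigma> \<noteq> {} \<and> (\<exists>g\<in>pverts G. \<sigma> \<subseteq> (\<lambda>p. {p}) ` (out_nbhd G g \<times> {0, 1}))"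
proof -
  have nbhd: "out_nbhd I1 0 = {0, 1}" "out_nbhd I1 1 = {2}" "out_nbhd I1 2 = {}"
    by (auto simp: out_nbhd_def I1_def)
  have low: "layer_class G {2::nat} ` (A \<times> {0, 1}) = (\<lambda>p. {p}) ` (A \<times> {0, 1})" for A
    by (intro image_cong refl) (auto simp: layer_class_def)
  have top: "layer_class G {2::nat} ` (A \<times> {2}) = (if A = {} then {} else {apex G})" for A
    by (auto simp: layer_class_def apex_def)
  have verts: "pverts I1 = {0, 1, 2}"
    by (simp add: I1_def)
  have "\<sigma> \<in> out_nbhd_complex (mycielskian1 G) \<longleftrightarrow> \<sigma> \<noteq> {} \<and> (\<exists>g\<in>pverts G.
      \<sigma> \<subseteq> (\<lambda>p. {p}) ` (out_nbhd G g \<times> {0, 1}) \<or> \<sigma> \<subseteq> (if out_nbhd G g = {} then {} else {apex G}))"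
    unfolding mycielskian1_def out_nbhd_complex_merge_layers[OF G pair_fin_digraph_I(1)]
    by (auto simp add: verts nbhd low top simp del: One_nat_def)
  also have "\<dots> \<longleftrightarrow> \<sigma> = {apex G} \<or> \<sigma> \<noteq> {} \<and> (\<exists>g\<in>pverts G. \<sigma> \<subseteq> (\<lambda>p. {p}) ` (out_nbhd G g \<times> {0, 1}))"
    (is "?l \<longleftrightarrow> ?r")
  proof
    assume ?l
    then obtain g where g: "\<sigma> \<noteq> {}" "g \<in> pverts G"
      "\<sigma> \<subseteq> (\<lambda>p. {p}) ` (out_nbhd G g \<times> {0, 1}) \<or> \<sigma> \<subseteq> (if out_nbhd G g = {} then {} else {apex G})"
      by blast
    from g(3) show ?r
    proof
      assume "\<sigma> \<subseteq> (\<lambda>p. {p}) ` (out_nbhd G g \<times> {0, 1})"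
      then show ?r
        using g(1,2) by blast
    next
      assume "\<sigma> \<subseteq> (if out_nbhd G g = {} then {} else {apex G})"
      then show ?r
        using g(1) by (simp add: subset_singleton_iff split: if_splits)
    qed
  next
    assume ?r
    moreover obtain g where "g \<in> pverts G" "out_nbhd G g \<noteq> {}"
      using exists_out_nbhd by blast
    ultimately show ?l
      by (elim disjE) auto
  qed
  finally show ?thesis .
qed

text \<open>
  The merged vertex is not in any face, since no arc of the product enters layer \<open>2\<close>.  It does see
  every \<open>(v, 1)\<close> with \<open>v\<close> of positive in-degree, which is the source of the simplex.
\<close>
lemma out_nbhd_complex_mycielskian2:
  "\<sigma> \<in> out_nbhd_complex (mycielskian2 G) \<longleftrightarrow>
    \<sigma> \<noteq> {} \<and> ((\<exists>g\<in>pverts G. \<sigma> \<subseteq> (\<lambda>v. {(v, 0)}) ` out_nbhd G g) \<or> \<sigma> \<subseteq> (\<lambda>v. {(v, 1)}) ` \<Union>(out_nbhd_complex G))"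
proof -
  have nbhd: "out_nbhd I2 0 = {0}" "out_nbhd I2 1 = {0}" "out_nbhd I2 2 = {1}"
    by (auto simp: out_nbhd_def I2_def)
  have low: "layer_class G {2::nat} ` (A \<times> {i}) = (\<lambda>v. {(v, i)}) ` A" if "i \<noteq> 2" for A i
    using that by (auto simp: layer_class_def)
  have "pverts I2 = {0, 1, 2}"
    by (simp add: I2_def)
  then have "\<sigma> \<in> out_nbhd_complex (mycielskian2 G) \<longleftrightarrow> \<sigma> \<noteq> {} \<and> (\<exists>g\<in>pverts G.
      \<sigma> \<subseteq> (\<lambda>v. {(v, 0)}) ` out_nbhd G g \<or> \<sigma> \<subseteq> (\<lambda>v. {(v, 1)}) ` \<Union>(out_nbhd_complex G))"
    unfolding mycielskian2_def out_nbhd_complex_merge_layers[OF G pair_fin_digraph_I(2)] Union_out_nbhd_complex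
    by (simp add: nbhd low del: One_nat_def)
  then show ?thesis
    using exists_out_nbhd by meson
qed

lemma out_nbhd_complex_mycielskian3:
  "\<sigma> \<in> out_nbhd_complex (mycielskian3 G) \<longleftrightarrow>
    \<sigma> \<noteq> {} \<and> ((\<exists>g\<in>pverts G. out_nbhd G g \<noteq> {} \<and> \<sigma> \<subseteq> insert (apex G) ((\<lambda>v. {(v, 1)}) ` out_nbhd G g)) \<or> \<sigma> \<subseteq> (\<lambda>v. {(v, 1)}) ` \<Union>(out_nbhd_complex G))"
proof -
  have nbhd: "out_nbhd I3 0 = {1}" "out_nbhd I3 1 = {1, 2}" "out_nbhd I3 2 = {}"
    by (auto simp: out_nbhd_def I3_def)
  have low: "layer_class G {0, 2::nat} ` (A \<times> {1}) = (\<lambda>v. {(v, 1)}) ` A" for A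
    by (auto simp: layer_class_def)
  have top: "layer_class G {0, 2::nat} ` (A \<times> {1, 2}) =
      (if A = {} then {} else insert (apex G) ((\<lambda>v. {(v, 1)}) ` A))" for A
  proof -
    have "A \<times> {1, 2::nat} = A \<times> {1} \<union> A \<times> {2}"
      by auto
    moreover have "layer_class G {0, 2::nat} ` (A \<times> {2}) = (if A = {} then {} else {apex G})"
    proof -
      have "layer_class G {0, 2::nat} p = apex G" if "p \<in> A \<times> {2}" for p
        using that by (auto simp: layer_class_def apex_def)
      then show ?thesis
        by (auto simp: image_iff)
    qed
    ultimately show ?thesis
      by (auto simp: image_Un low simp del: One_nat_def)
  qed
  have verts: "pverts I3 = {0, 1, 2}"
    by (simp add: I3_def)
  have "\<sigma> \<in> out_nbhd_complex (mycielskian3 G) \<longleftrightarrow> \<sigma> \<noteq> {} \<and> (\<exists>g\<in>pverts G. \<sigma> \<subseteq> (\<lambda>v. {(v, 1)}) ` \<Union>(out_nbhd_complex G) \<or>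
      \<sigma> \<subseteq> (if out_nbhd G g = {} then {} else insert (apex G) ((\<lambda>v. {(v, 1)}) ` out_nbhd G g)))"
    unfolding mycielskian3_def out_nbhd_complex_merge_layers[OF G pair_fin_digraph_I(3)] Union_out_nbhd_complex
    by (auto simp add: nbhd low top verts simp del: One_nat_def)
  then show ?thesis
    using exists_out_nbhd by (auto split: if_splits)
qed

text \<open>
  The map \<open>\<phi>\<close> forgets the layer and \<open>\<psi>\<close> includes the complex of \<open>G\<close> as layer \<open>0\<close>.  Applying \<open>\<psi> \<circ> \<phi>\<close> moves layer \<open>1\<close>
  to layer \<open>0\<close>, which stays inside \<open>out_nbhd G g \<times> {0, 1}\<close>.  The simplex collapses to its vertex \<open>0\<close>, whatever its
  dimension \<open>m\<close>; this freedom allows the comparison with both a point and the simplex of the second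
  Mycielskian.
\<close>
lemma mycielskian1_homotopy_equivalent:
  "realization (out_nbhd_complex (mycielskian1 G)) homotopy_equivalent_space
    realization (complex_disjoint_union (out_nbhd_complex G) (simplex_complex m))"
proof -
  let ?K = "out_nbhd_complex (mycielskian1 G)" and ?L = "complex_disjoint_union (out_nbhd_complex G) (simplex_complex m)"
  \<comment> \<open>Layers \<open>0\<close> and \<open>1\<close> consist of singleton classes, whose element is the one chosen.\<close>
  define \<phi> :: "('a \<times> nat) set \<Rightarrow> 'a + nat"
    where "\<phi> A = (let p = SOME p. p \<in> A in if snd p = 2 then Inr 0 else Inl (fst p))" for A
  define \<psi> :: "'a + nat \<Rightarrow> ('a \<times> nat) set"
    where "\<psi> w = (case w of Inl v \<Rightarrow> {(v, 0)} | Inr _ \<Rightarrow> apex G)" for w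
  have \<phi>_single: "\<phi> {(v, i)} = Inl v" if "i \<in> {0, 1}" for v i
    using that by (auto simp: \<phi>_def)
  have \<phi>_apex: "\<phi> (apex G) = Inr 0"
  proof -
    obtain g where "g \<in> pverts G"
      using exists_out_nbhd by blast
    then have "(g, 2) \<in> apex G"
      by (simp add: apex_def)
    then have "(SOME p. p \<in> apex G) \<in> apex G"
      by (rule someI)
    then have "snd (SOME p. p \<in> apex G) = 2"
      unfolding apex_def by (rule mem_Times_iff[THEN iffD1, THEN conjunct2, THEN singletonD])
    then show ?thesis
      unfolding \<phi>_def Let_def by (simp only: if_True refl)
  qed
  have L: "\<tau> \<in> ?L \<longleftrightarrow> (\<exists>\<rho>\<in>(out_nbhd_complex G). \<tau> = Inl ` \<rho>) \<or> (\<exists>\<rho>. \<rho> \<noteq> {} \<and> \<rho> \<subseteq> {0..m} \<and> \<tau> = Inr ` \<rho>)" for \<tau>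
    by (auto simp: complex_disjoint_union_def simplex_complex_def)
  note K = out_nbhd_complex_mycielskian1
  have \<phi>_low: "\<phi> ` \<sigma> \<in> (`) Inl ` (out_nbhd_complex G) \<and> \<psi> ` \<phi> ` \<sigma> \<subseteq> (\<lambda>p. {p}) ` (out_nbhd G g \<times> {0, 1})"
    if \<sigma>: "\<sigma> \<noteq> {}" "g \<in> pverts G" "\<sigma> \<subseteq> (\<lambda>p. {p}) ` (out_nbhd G g \<times> {0, 1})" for \<sigma> g
  proof -
    have "\<phi> ` \<sigma> \<subseteq> Inl ` out_nbhd G g"
    proof
      fix w assume "w \<in> \<phi> ` \<sigma>"
      then obtain v i where "w = \<phi> {(v, i)}" "v \<in> out_nbhd G g" "i \<in> {0, 1}"
        using \<sigma>(3) by auto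
      then show "w \<in> Inl ` out_nbhd G g"
        using \<phi>_single by simp
    qed
    then obtain \<rho> where \<rho>: "\<rho> \<subseteq> out_nbhd G g" "\<phi> ` \<sigma> = Inl ` \<rho>"
      by (meson subset_image_iff)
    then have "\<rho> \<in> out_nbhd_complex G"
      using \<sigma>(1,2) by (auto simp: out_nbhd_complex_def)
    moreover have "\<psi> ` \<phi> ` \<sigma> \<subseteq> (\<lambda>p. {p}) ` (out_nbhd G g \<times> {0, 1})"
      using \<rho>(1) unfolding \<rho>(2) \<psi>_def by auto
    ultimately show ?thesis
      using \<rho>(2) by blast
  qed
  have \<psi>_low: "\<psi> ` Inl ` \<rho> \<in> ?K \<and> \<phi> ` \<psi> ` Inl ` \<rho> = Inl ` \<rho>" if \<rho>: "\<rho> \<in> out_nbhd_complex G" for \<rho>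
  proof -
    obtain g where "g \<in> pverts G" "\<rho> \<noteq> {}" "\<rho> \<subseteq> out_nbhd G g"
      using \<rho> by (auto simp: out_nbhd_complex_def)
    then have "\<psi> ` Inl ` \<rho> \<in> ?K"
      unfolding K \<psi>_def image_image by (intro disjI2 conjI bexI[of _ g]) auto
    moreover have "\<phi> ` \<psi> ` Inl ` \<rho> = Inl ` \<rho>"
      unfolding image_image by (intro image_cong refl) (simp add: \<psi>_def \<phi>_single)
    ultimately show ?thesis ..
  qed
  have \<psi>_high: "\<psi> ` Inr ` \<rho> = {apex G}" if "\<rho> \<noteq> {}" for \<rho>
    unfolding image_image using that by (auto simp: \<psi>_def)
  have K_cases: thesis if "\<sigma> \<in> ?K" "\<sigma> = {apex G} \<Longrightarrow> thesis"
    "\<And>g. \<sigma> \<noteq> {} \<Longrightarrow> g \<in> pverts G \<Longrightarrow> \<sigma> \<subseteq> (\<lambda>p. {p}) ` (out_nbhd G g \<times> {0, 1}) \<Longrightarrow> thesis" for \<sigma> thesis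
    using that(1) unfolding K by (elim disjE conjE bexE) (erule that(2), rule that(3))
  have L_cases: thesis if "\<tau> \<in> ?L" "\<And>\<rho>. \<rho> \<in> out_nbhd_complex G \<Longrightarrow> \<tau> = Inl ` \<rho> \<Longrightarrow> thesis"
    "\<And>\<rho>. \<rho> \<noteq> {} \<Longrightarrow> \<rho> \<subseteq> {0..m} \<Longrightarrow> \<tau> = Inr ` \<rho> \<Longrightarrow> thesis" for \<tau> thesis
    using that(1) unfolding L by (elim disjE conjE bexE exE) (rule that(2), assumption+, rule that(3), assumption+)
  have zero: "Inr ` {0} \<in> ?L"
    unfolding L by (intro disjI2 exI[of _ "{0}"]) simp
  show ?thesis
  proof (rule homotopy_equivalent_realizations[where \<phi> = \<phi> and \<psi> = \<psi>])
    show "abstract_simplicial_complex ?K" "finite (\<Union>?K)"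
      using abstract_simplicial_complex_out_nbhd_complex finite_out_nbhd_complex pair_fin_digraph_mycielskian(1)[OF G]
      by blast+
    show "abstract_simplicial_complex ?L" "finite (\<Union>?L)"
      using abstract_simplicial_complex_out_nbhd_complex[OF G] finite_out_nbhd_complex[OF G]
      by (auto intro: abstract_simplicial_complex_disjoint_union finite_disjoint_union
        abstract_simplicial_complex_simplex finite_simplex)
    show "\<phi> ` \<sigma> \<in> ?L" if "\<sigma> \<in> ?K" for \<sigma>
      using that
    proof (rule K_cases)
      assume "\<sigma> = {apex G}"
      then show ?thesis
        using zero by (simp add: \<phi>_apex)
    next
      fix g assume "\<sigma> \<noteq> {}" "g \<in> pverts G" "\<sigma> \<subseteq> (\<lambda>p. {p}) ` (out_nbhd G g \<times> {0, 1})"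
      from \<phi>_low[OF this, THEN conjunct1] show ?thesis
        unfolding L by (auto elim!: imageE)
    qed
    show "\<psi> ` \<phi> ` \<sigma> \<union> \<sigma> \<in> ?K" if "\<sigma> \<in> ?K" for \<sigma>
      using that
    proof (rule K_cases)
      assume "\<sigma> = {apex G}"
      then have "\<psi> ` \<phi> ` \<sigma> \<union> \<sigma> = {apex G}"
        by (simp add: \<phi>_apex \<psi>_def)
      then show ?thesis
        unfolding K by blast
    next
      fix g assume g: "\<sigma> \<noteq> {}" "g \<in> pverts G" "\<sigma> \<subseteq> (\<lambda>p. {p}) ` (out_nbhd G g \<times> {0, 1})"
      from \<phi>_low[OF this] show ?thesis
        unfolding K using g by (intro disjI2 conjI bexI[of _ g]) auto
    qed
    show "\<psi> ` \<tau> \<in> ?K" if "\<tau> \<in> ?L" for \<tau>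
      using that
    proof (rule L_cases)
      fix \<rho> assume "\<rho> \<in> out_nbhd_complex G" "\<tau> = Inl ` \<rho>"
      then show ?thesis
        using \<psi>_low by simp
    next
      fix \<rho> assume "\<rho> \<noteq> {}" "\<tau> = Inr ` \<rho>"
      then show ?thesis
        unfolding K by (simp add: \<psi>_high)
    qed
    show "\<phi> ` \<psi> ` \<tau> \<union> \<tau> \<in> ?L" if "\<tau> \<in> ?L" for \<tau>
      using that
    proof (rule L_cases)
      fix \<rho> assume "\<rho> \<in> out_nbhd_complex G" "\<tau> = Inl ` \<rho>"
      then show ?thesis
        using \<psi>_low that by simp
    next
      fix \<rho> assume \<rho>: "\<rho> \<noteq> {}" "\<rho> \<subseteq> {0..m}" "\<tau> = Inr ` \<rho>"
      have "\<phi> ` \<psi> ` \<tau> \<union> \<tau> = Inr ` insert 0 \<rho>"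
        using \<rho>(1) by (simp add: \<rho>(3) \<psi>_high \<phi>_apex)
      then show ?thesis
        unfolding L using \<rho>(2) by (intro disjI2 exI[of _ "insert 0 \<rho>"]) auto
    qed
  qed
qed

lemma mycielskian2_isomorphic:
  assumes n: "card (\<Union>(out_nbhd_complex G)) = n" "n > 0"
  shows "complex_isomorphic (out_nbhd_complex (mycielskian2 G))
    (complex_disjoint_union (out_nbhd_complex G) (simplex_complex (n - 1)))"
proof -
  let ?K = "out_nbhd_complex (mycielskian2 G)" and ?L = "complex_disjoint_union (out_nbhd_complex G) (simplex_complex (n - 1))"
  have interval: "{0..n - 1} = {0..<n}"
    using n(2) by auto
  obtain e where "bij_betw e {0..<n} (\<Union>(out_nbhd_complex G))"
    using ex_bij_betw_nat_finite[OF finite_out_nbhd_complex[OF G]] n(1) by blast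
  then have e: "inj_on e {0..<n}" "e ` {0..<n} = \<Union>(out_nbhd_complex G)"
    by (auto simp: bij_betw_def)
  define c :: "'a + nat \<Rightarrow> ('a \<times> nat) set"
    where "c w = (case w of Inl v \<Rightarrow> {(v, 0)} | Inr j \<Rightarrow> {(e j, 1)})" for w
  have UL: "\<Union>?L \<subseteq> \<Union>(out_nbhd_complex G) <+> {0..<n}"
    unfolding complex_disjoint_union_def simplex_complex_def interval by auto
  have "inj_on c (\<Union>(out_nbhd_complex G) <+> {0..<n})"
  proof (rule inj_onI)
    fix x y assume "x \<in> \<Union>(out_nbhd_complex G) <+> {0..<n}" "y \<in> \<Union>(out_nbhd_complex G) <+> {0..<n}" "c x = c y"
    then show "x = y"
      using inj_onD[OF e(1)] by (cases x; cases y) (auto simp add: c_def simp del: Union_iff)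
  qed
  then have inj: "inj_on c (\<Union>?L)"
    using UL by (rule inj_on_subset)
  have "?K = (`) c ` ?L"
  proof (intro set_eqI iffI)
    fix \<sigma> assume "\<sigma> \<in> ?K"
    then consider g where "\<sigma> \<noteq> {}" "g \<in> pverts G" "\<sigma> \<subseteq> (\<lambda>v. {(v, 0)}) ` out_nbhd G g"
      | "\<sigma> \<noteq> {}" "\<sigma> \<subseteq> (\<lambda>v. {(v, 1)}) ` e ` {0..<n}"
      unfolding out_nbhd_complex_mycielskian2 e(2) by blast
    then show "\<sigma> \<in> (`) c ` ?L"
    proof cases
      case (1 g)
      then obtain \<tau> where \<tau>: "\<tau> \<subseteq> out_nbhd G g" "\<sigma> = (\<lambda>v. {(v, 0)}) ` \<tau>"
        by (meson subset_image_iff)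
      then have "\<tau> \<in> out_nbhd_complex G"
        using 1 by (auto simp: out_nbhd_complex_def)
      moreover have "\<sigma> = c ` Inl ` \<tau>"
        by (simp add: \<tau>(2) c_def image_image)
      ultimately show ?thesis
        unfolding complex_disjoint_union_def by blast
    next
      case 2
      then obtain \<tau> where \<tau>: "\<tau> \<subseteq> {0..<n}" "\<sigma> = (\<lambda>j. {(e j, 1)}) ` \<tau>"
        unfolding image_image by (meson subset_image_iff)
      then have "\<tau> \<in> simplex_complex (n - 1)"
        using 2 by (auto simp: simplex_complex_def interval)
      moreover have "\<sigma> = c ` Inr ` \<tau>"
        by (simp add: \<tau>(2) c_def image_image)
      ultimately show ?thesis
        unfolding complex_disjoint_union_def by blast
    qed
  next
    fix \<sigma> assume "\<sigma> \<in> (`) c ` ?L"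
    then consider \<tau> where "\<tau> \<in> out_nbhd_complex G" "\<sigma> = c ` Inl ` \<tau>" | \<tau> where "\<tau> \<in> simplex_complex (n - 1)" "\<sigma> = c ` Inr ` \<tau>"
      unfolding complex_disjoint_union_def by blast
    then show "\<sigma> \<in> ?K"
    proof cases
      case (1 \<tau>)
      then obtain g where "g \<in> pverts G" "\<tau> \<noteq> {}" "\<tau> \<subseteq> out_nbhd G g"
        by (auto simp: out_nbhd_complex_def)
      then show ?thesis
        unfolding out_nbhd_complex_mycielskian2 1(2) image_image
        by (intro conjI disjI1 bexI[of _ g]) (auto simp: c_def)
    next
      case (2 \<tau>)
      then have "\<tau> \<noteq> {}" "e ` \<tau> \<subseteq> \<Union>(out_nbhd_complex G)"
        unfolding simplex_complex_def interval e(2)[symmetric] by (simp_all add: image_mono)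
      moreover have "\<sigma> = (\<lambda>v. {(v, 1)}) ` e ` \<tau>"
        by (simp add: 2(2) c_def image_image)
      ultimately show ?thesis
        unfolding out_nbhd_complex_mycielskian2 by (simp add: image_mono)
    qed
  qed
  then show ?thesis
    using complex_isomorphic_image[OF inj] by simp
qed

text \<open>
  The apex of the cone is the merged vertex of layer \<open>2\<close>, seen by every \<open>(g, 1)\<close> with an out-neighbor;
  the simplex comes from the merged vertex of layer \<open>0\<close>.
\<close>
lemma mycielskian3_isomorphic:
  "complex_isomorphic (out_nbhd_complex (mycielskian3 G)) (cone_with_simplex (out_nbhd_complex G))"
proof -
  let ?K = "out_nbhd_complex (mycielskian3 G)" and ?L = "cone_with_simplex (out_nbhd_complex G)"
  define c :: "'a + bool \<Rightarrow> ('a \<times> nat) set"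
    where "c w = (case w of Inl v \<Rightarrow> {(v, 1)} | Inr _ \<Rightarrow> apex G)" for w
  have c: "c (Inl v) = {(v, 1)}" "c (Inr b) = apex G" for v b
    by (simp_all add: c_def)
  have not_apex: "{(v, 1)} \<noteq> apex G" for v
  proof
    assume "{(v, 1)} = apex G"
    then have "(v, 1) \<in> apex G"
      by blast
    then show False
      by (simp add: apex_def)
  qed
  have "Inr False \<notin> \<Union>?L"
    by (auto simp: cone_with_simplex_def)
  moreover have "inj_on c (- {Inr False})"
  proof (rule inj_onI)
    fix x y assume "x \<in> - {Inr False}" "y \<in> - {Inr False}" "c x = c y"
    then show "x = y"
      using not_apex not_apex[symmetric] by (cases x; cases y) (auto simp: c simp del: One_nat_def)
  qed
  ultimately have inj: "inj_on c (\<Union>?L)"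
    by (metis Compl_iff inj_on_subset singletonD subsetI)
  have "?K = (`) c ` ?L"
  proof (intro set_eqI iffI)
    fix \<sigma> assume "\<sigma> \<in> ?K"
    then consider g where "\<sigma> \<noteq> {}" "g \<in> pverts G" "out_nbhd G g \<noteq> {}" "\<sigma> \<subseteq> insert (apex G) ((\<lambda>v. {(v, 1)}) ` out_nbhd G g)"
      | "\<sigma> \<noteq> {}" "\<sigma> \<subseteq> (\<lambda>v. {(v, 1)}) ` \<Union>(out_nbhd_complex G)"
      unfolding out_nbhd_complex_mycielskian3 by blast
    then show "\<sigma> \<in> (`) c ` ?L"
    proof cases
      case (1 g)
      have "insert (apex G) ((\<lambda>v. {(v, 1)}) ` out_nbhd G g) = c ` insert (Inr True) (Inl ` out_nbhd G g)"
        by (simp add: c image_image)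
      then obtain \<tau> where \<tau>: "\<tau> \<subseteq> insert (Inr True) (Inl ` out_nbhd G g)" "\<sigma> = c ` \<tau>"
        using 1 by (metis subset_image_iff)
      then have "Inl -` \<tau> \<subseteq> out_nbhd G g" "Inr False \<notin> \<tau>"
        by auto
      then have "\<tau> \<in> ?L"
        using \<tau> 1 by (auto simp: cone_with_simplex_def out_nbhd_complex_def)
      then show ?thesis
        using \<tau>(2) by blast
    next
      case 2
      have "(\<lambda>v. {(v, 1)}) ` \<Union>(out_nbhd_complex G) = c ` Inl ` \<Union>(out_nbhd_complex G)"
        unfolding image_image by (simp add: c)
      then obtain \<tau> where \<tau>: "\<tau> \<subseteq> Inl ` \<Union>(out_nbhd_complex G)" "\<sigma> = c ` \<tau>"
        using 2 by (metis subset_image_iff)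
      then have "\<tau> \<in> ?L"
        using 2 unfolding cone_with_simplex_def by blast
      then show ?thesis
        using \<tau>(2) by blast
    qed
  next
    fix \<sigma> assume "\<sigma> \<in> (`) c ` ?L"
    then obtain \<tau> where \<tau>: "\<tau> \<in> ?L" "\<sigma> = c ` \<tau>"
      by blast
    have ne: "\<sigma> \<noteq> {}"
      using \<tau> by (auto simp: cone_with_simplex_def)
    from \<tau>(1) consider "\<tau> \<subseteq> Inl ` \<Union>(out_nbhd_complex G)" | "Inl -` \<tau> \<in> insert {} (out_nbhd_complex G)"
      unfolding cone_with_simplex_def by blast
    then show "\<sigma> \<in> ?K"
    proof cases
      case 1
      then have "\<sigma> \<subseteq> c ` Inl ` \<Union>(out_nbhd_complex G)"
        unfolding \<tau>(2) by (rule image_mono)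
      also have "\<dots> = (\<lambda>v. {(v, 1)}) ` \<Union>(out_nbhd_complex G)"
        unfolding image_image by (simp add: c)
      finally show ?thesis
        unfolding out_nbhd_complex_mycielskian3 using ne by blast
    next
      case 2
      obtain g where g: "g \<in> pverts G" "out_nbhd G g \<noteq> {}" "Inl -` \<tau> \<subseteq> out_nbhd G g"
      proof (cases "Inl -` \<tau> = {}")
        case True
        then show ?thesis
          using exists_out_nbhd that by auto
      next
        case False
        then show ?thesis
          using 2 that by (auto simp: out_nbhd_complex_def)
      qed
      have "c w \<in> insert (apex G) ((\<lambda>v. {(v, 1)}) ` out_nbhd G g)" if "w \<in> \<tau>" for w
        using that g(3) by (cases w) (auto simp: c)
      then show ?thesis
        unfolding out_nbhd_complex_mycielskian3 \<tau>(2)[symmetric] using ne g \<tau>(2) by (intro conjI disjI1 bexI[of _ g]) auto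
    qed
  qed
  then show ?thesis
    using complex_isomorphic_image[OF inj] by simp
qed

end

section \<open>The three homotopy types\<close>

theorem proposition4p9:
  fixes G :: "'a pair_pre_digraph" and n :: nat
  assumes "pair_fin_digraph G"
    and "card (complex_verts (out_nbhd_complex G)) = n"
    and "n > 0"
  shows "realization (out_nbhd_complex (mycielskian1 G)) homotopy_equivalent_space
           disjoint_point (realization (out_nbhd_complex G))
       \<and> complex_isomorphic (out_nbhd_complex (mycielskian2 G))
           (complex_disjoint_union (out_nbhd_complex G) (simplex_complex (n - 1)))
       \<and> realization (out_nbhd_complex (mycielskian1 G)) homotopy_equivalent_space
           realization (out_nbhd_complex (mycielskian2 G))
       \<and> realization (out_nbhd_complex (mycielskian3 G)) homotopy_equivalent_space
           suspension (realization (out_nbhd_complex G))"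
proof -
  let ?N = "out_nbhd_complex G" and ?D = "\<lambda>m. complex_disjoint_union (out_nbhd_complex G) (simplex_complex m)"
  have card: "card (\<Union>?N) = n"
    using assms(2) by (simp add: complex_verts_def)
  then have ne: "?N \<noteq> {}"
    using assms(3) by auto
  note complex = abstract_simplicial_complex_out_nbhd_complex finite_out_nbhd_complex
  note N = complex[OF assms(1)]
  note M2 = complex[OF pair_fin_digraph_mycielskian(2)[OF assms(1)]]
  note M3 = complex[OF pair_fin_digraph_mycielskian(3)[OF assms(1)]]
  have D: "abstract_simplicial_complex (?D m)" "finite (\<Union>(?D m))" for m
    using N abstract_simplicial_complex_simplex finite_simplex
    by (auto intro: abstract_simplicial_complex_disjoint_union finite_disjoint_union)
  have first: "realization (out_nbhd_complex (mycielskian1 G)) homotopy_equivalent_space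
      disjoint_point (realization ?N)"
    using mycielskian1_homotopy_equivalent[OF assms(1) ne, of 0]
      homeomorphic_imp_homotopy_equivalent_space[OF disjoint_point_homeomorphic[OF N]]
    by (metis homotopy_equivalent_space_sym homotopy_eqv_trans)
  have second: "complex_isomorphic (out_nbhd_complex (mycielskian2 G)) (?D (n - 1))"
    by (rule mycielskian2_isomorphic[OF assms(1) ne card assms(3)])
  have third: "realization (out_nbhd_complex (mycielskian1 G)) homotopy_equivalent_space
      realization (out_nbhd_complex (mycielskian2 G))"
    using mycielskian1_homotopy_equivalent[OF assms(1) ne, of "n - 1"]
      complex_isomorphic_imp_homotopy_equivalent[OF M2 D second]
    by (metis homotopy_equivalent_space_sym homotopy_eqv_trans)
  have "realization (out_nbhd_complex (mycielskian3 G)) homotopy_equivalent_space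
      realization (cone_with_simplex ?N)"
  proof (rule complex_isomorphic_imp_homotopy_equivalent[OF M3])
    show "abstract_simplicial_complex (cone_with_simplex ?N)"
      by (rule abstract_simplicial_complex_cone_with_simplex[OF N])
    show "finite (\<Union>(cone_with_simplex ?N))"
      using Union_cone_with_simplex_subset by (rule finite_subset) (rule finite_Plus[OF N(2) finite])
    show "complex_isomorphic (out_nbhd_complex (mycielskian3 G)) (cone_with_simplex ?N)"
      by (rule mycielskian3_isomorphic[OF assms(1) ne])
  qed
  moreover note cone_with_simplex_homotopy_equivalent_suspension_complex[OF N ne]
  moreover have "suspension (realization ?N) homotopy_equivalent_space realization (suspension_complex ?N)"
    by (rule homeomorphic_imp_homotopy_equivalent_space[OF suspension_homeomorphic[OF N ne]])
  ultimately have "realization (out_nbhd_complex (mycielskian3 G)) homotopy_equivalent_space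
      suspension (realization ?N)"
    by (meson homotopy_equivalent_space_sym homotopy_eqv_trans)
  then show ?thesis
    using first second third by blast
qed

end
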